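(* Let $H$ be a real Hilbert space, $\Omega\subseteq H$ a nonempty open set, $F:\Omega\to H$ a continuous function with continuous Fréchet derivative $F'$, $T:H\rightrightarrows H$ a set-valued maximal monotone operator and $x^*\in\Omega$. Suppose that $0\in F(x^* )+T(x^* )$, that $F'(x^* )$ is a positive operator and that $\widehat{F'(x^* )}^{-1}$ exists. Let $R>0$ and $\kappa:=\sup\{t\in[0,R): B(x^*,t)\subset\Omega\}$. Suppose that there exists a twice continuously differentiable $f:[0,R)\to\mathbb{R}$ such that $$\|\widehat{F'(x^* )}^{-1}\|\,\|F'(x)-F'(x^*+\tau(x-x^* ))\|\le f'(\|x-x^*\|)-f'(\tau\|x-x^*\|)$$ for all $\tau\in[0,1]$ and $x\in B(x^*,\kappa)$, and such that (h1) $f(0)=0$ and $f'(0)=-1$; (h2) $f'$ is convex and strictly increasing. Let $$\nu:=\sup\{t\in[0,R): f'(t)<0\},\quad \rho:=\sup\{t\in(0,\nu): f(t)/(tf'(t))-1<1\},\quad r:=\min\{\kappa,\rho\}.$$ Then, for every starting point $x_0\in B(x^*,r)\setminus\{x^*\}$ and $t_0=\|x^*-x_0\|$, the sequences given respectively by $$0\in F(x_k)+F'(x_k)(x_{k+1}-x_k)+T(x_{k+1}),\qquad t_{k+1}=|t_k-f(t_k)/f'(t_k)|,\qquad k=0,1,\ldots$$ are well defined; $\{t_k\}$ is strictly decreasing, is contained in $(0,r)$ and converges to $0$; $\{x_k\}$ is contained in $B(x^*,r)$ and converges to the point $x^*$, which is the unique solution of $F(x)+T(x)\ni 0$ in $B(x^*,\bar\sigma)$,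 where $\bar\sigma=\min\{r,\sigma\}$ and $\sigma:=\sup\{0<t<\kappa: f(t)<0\}$. Moreover, the sequence $\{t_{k+1}/t_k^2\}$ is strictly decreasing and $$\|x^*-x_{k+1}\|\le [t_{k+1}/t_k^2]\,\|x_k-x^*\|^2,\qquad t_{k+1}/t_k^2\le f''(t_0)/(2|f'(t_0)|),\qquad k=0,1,\ldots.$$ If, additionally, $f(\rho)/(\rho f'(\rho))-1=1$ and $\rho<\kappa$, then $r=\rho$ is the optimal convergence radius.
   Context: $B(x,\delta)$ denotes the open ball with centre $x$ and radius $\delta$. A bounded linear operator $G:H\to H$ is positive if it is self-adjoint and $\langle Gx,x\rangle\ge 0$ for all $x\in H$. For a bounded linear $G$ with adjoint $G^*$, $\widehat G:=\frac12(G+G^* )$. A set-valued operator $T:H\rightrightarrows H$ with $\mathrm{dom}\,T=\{x: T(x)\ne\varnothing\}$ is monotone if $\langle u-v,y-x\rangle\ge 0$ whenever $u\in T(y)$, $v\in T(x)$; it is maximal monotone if it is monotone and whenever $x,u\in H$ satisfy $\langle u-v,x-y\rangle\ge0$ for all $y\in\mathrm{dom}\,T$, $v\in T(y)$, then $u\in T(x)$. "$\{x_k\}$ is well defined" means that at each step $x_k\in\Omega$ and there is exactly one $x_{k+1}\in H$ satisfying the inclusion. "Optimal convergence radius" is meant with respect to the majorant condition: the radius $\rho$ cannot be enlarged for the given $f$. That is, for the given $R$, $f$, $\kappa$ there exist a real Hilbert space, an open set, a function, a maximal monotone operator and a solution satisfying all the hypotheses of the theorem with the same $R$, $f$, $\kappa$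 (hence the same $\rho$), and a starting point at distance exactly $\rho$ from that solution, for which the Newton sequence defined by the inclusion above is well defined but does not converge to that solution. *)

theory Defs
  imports "HOL-Analysis.Analysis"
begin

text \<open>
  A real Hilbert space is a type of class \<open>{real_inner, complete_space}\<close>. On a Hilbert space
  every bounded operator has a bounded adjoint (Riesz), so \<open>Blinfun\<close> below is applied to a
  bounded linear map.
\<close>

definition blinfun_adjoint ::
    "('a::real_inner \<Rightarrow>\<^sub>L 'b::real_inner) \<Rightarrow> ('b \<Rightarrow>\<^sub>L 'a)" where
  "blinfun_adjoint G = Blinfun (adjoint (blinfun_apply G))"

definition hat_op :: "('a::real_inner \<Rightarrow>\<^sub>L 'a) \<Rightarrow> ('a \<Rightarrow>\<^sub>L 'a)" where
  "hat_op G = (1 / 2) *\<^sub>R (G + blinfun_adjoint G)"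

definition positive_op :: "('a::real_inner \<Rightarrow>\<^sub>L 'a) \<Rightarrow> bool" where
  "positive_op G \<longleftrightarrow>
     (\<forall>x y. G x \<bullet> y = x \<bullet> G y) \<and> (\<forall>x. 0 \<le> G x \<bullet> x)"

definition is_inverse_op ::
    "('a::real_normed_vector \<Rightarrow>\<^sub>L 'a) \<Rightarrow> ('a \<Rightarrow>\<^sub>L 'a) \<Rightarrow> bool" where
  "is_inverse_op A B \<longleftrightarrow> A o\<^sub>L B = id_blinfun \<and> B o\<^sub>L A = id_blinfun"

definition invertible_op :: "('a::real_normed_vector \<Rightarrow>\<^sub>L 'a) \<Rightarrow> bool" where
  "invertible_op A \<longleftrightarrow> (\<exists>B. is_inverse_op A B)"

definition inverse_op :: "('a::real_normed_vector \<Rightarrow>\<^sub>L 'a) \<Rightarrow> ('a \<Rightarrow>\<^sub>L 'a)" where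
  "inverse_op A = (THE B. is_inverse_op A B)"

definition set_dom :: "('a \<Rightarrow> 'b set) \<Rightarrow> 'a set" where
  "set_dom T = {x. T x \<noteq> {}}"

definition monotone_op :: "('a::real_inner \<Rightarrow> 'a set) \<Rightarrow> bool" where
  "monotone_op T \<longleftrightarrow>
     (\<forall>x y u v. u \<in> T y \<longrightarrow> v \<in> T x \<longrightarrow> 0 \<le> (u - v) \<bullet> (y - x))"

definition maximal_monotone_op :: "('a::real_inner \<Rightarrow> 'a set) \<Rightarrow> bool" where
  "maximal_monotone_op T \<longleftrightarrow> monotone_op T \<and>
     (\<forall>x u. (\<forall>y\<in>set_dom T. \<forall>v\<in>T y. 0 \<le> (u - v) \<bullet> (x - y)) \<longrightarrow> u \<in> T x)"

text \<open>
  Functions with domain \<open>[0,R)\<close> or \<open>\<Omega>\<close> are total functions whose values elsewhere are never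
  used. The derivatives of \<open>f\<close> are taken within \<open>[0,R)\<close>, hence one-sided at \<open>0\<close>; there they are
  uniquely determined by \<open>f\<close>.
\<close>

definition majorant_function ::
    "real \<Rightarrow> (real \<Rightarrow> real) \<Rightarrow> (real \<Rightarrow> real) \<Rightarrow> (real \<Rightarrow> real) \<Rightarrow> bool" where
  "majorant_function R f f' f'' \<longleftrightarrow>
     (\<forall>t\<in>{0..<R}. (f has_real_derivative f' t) (at t within {0..<R})) \<and>
     (\<forall>t\<in>{0..<R}. (f' has_real_derivative f'' t) (at t within {0..<R})) \<and>
     continuous_on {0..<R} f'' \<and>
     f 0 = 0 \<and> f' 0 = -1 \<and>
     convex_on {0..<R} f' \<and> strict_mono_on {0..<R} f'"

definition majorized_problem ::
    "'a set \<Rightarrow> ('a::{real_inner, complete_space} \<Rightarrow> 'a) \<Rightarrow> ('a \<Rightarrow> 'a \<Rightarrow>\<^sub>L 'a) \<Rightarrow>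
     ('a \<Rightarrow> 'a set) \<Rightarrow> 'a \<Rightarrow> real \<Rightarrow> real \<Rightarrow> (real \<Rightarrow> real) \<Rightarrow> bool" where
  "majorized_problem \<Omega> F F' T xs R \<kappa> f' \<longleftrightarrow>
     open \<Omega> \<and> \<Omega> \<noteq> {} \<and> continuous_on \<Omega> F \<and>
     (\<forall>x\<in>\<Omega>. (F has_derivative blinfun_apply (F' x)) (at x)) \<and> continuous_on \<Omega> F' \<and>
     maximal_monotone_op T \<and>
     xs \<in> \<Omega> \<and> 0 \<in> F xs +o T xs \<and>
     positive_op (F' xs) \<and> invertible_op (hat_op (F' xs)) \<and>
     \<kappa> = Sup {t\<in>{0..<R}. ball xs t \<subseteq> \<Omega>} \<and>
     (\<forall>\<tau>\<in>{0..1}. \<forall>x\<in>ball xs \<kappa>.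
        norm (inverse_op (hat_op (F' xs))) * norm (F' x - F' (xs + \<tau> *\<^sub>R (x - xs)))
          \<le> f' (norm (x - xs)) - f' (\<tau> * norm (x - xs)))"

definition newton_step ::
    "('a::real_normed_vector \<Rightarrow> 'a) \<Rightarrow> ('a \<Rightarrow> 'a \<Rightarrow>\<^sub>L 'a) \<Rightarrow> ('a \<Rightarrow> 'a set) \<Rightarrow>
     'a \<Rightarrow> 'a \<Rightarrow> bool" where
  "newton_step F F' T x y \<longleftrightarrow> 0 \<in> (F x + F' x (y - x)) +o T y"

text \<open>
  The two predicates below include well-definedness: every iterate lies in the domain, and the
  next one exists uniquely (for \<open>t\<close>: the denominator does not vanish). For a given starting
  point each has at most one solution.
\<close>

definition newton_sequence ::
    "'a set \<Rightarrow> ('a::real_normed_vector \<Rightarrow> 'a) \<Rightarrow> ('a \<Rightarrow> 'a \<Rightarrow>\<^sub>L 'a) \<Rightarrow>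
     ('a \<Rightarrow> 'a set) \<Rightarrow> 'a \<Rightarrow> (nat \<Rightarrow> 'a) \<Rightarrow> bool" where
  "newton_sequence \<Omega> F F' T x0 x \<longleftrightarrow> x 0 = x0 \<and>
     (\<forall>k. x k \<in> \<Omega> \<and> (\<exists>!y. newton_step F F' T (x k) y) \<and>
          newton_step F F' T (x k) (x (Suc k)))"

definition majorant_sequence ::
    "real \<Rightarrow> (real \<Rightarrow> real) \<Rightarrow> (real \<Rightarrow> real) \<Rightarrow> real \<Rightarrow> (nat \<Rightarrow> real) \<Rightarrow> bool" where
  "majorant_sequence R f f' t0 t \<longleftrightarrow> t 0 = t0 \<and>
     (\<forall>k. t k \<in> {0..<R} \<and> f' (t k) \<noteq> 0 \<and> t (Suc k) = \<bar>t k - f (t k) / f' (t k)\<bar>)"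

end

theory Submission
  imports Defs
begin

text \<open>
  Since \<open>F'(x*)\<close> is coercive with constant \<open>1/\<beta>\<close>, where \<open>\<beta>\<close> is the norm of its inverse, the
  majorant condition gives \<open>\<beta> \<langle>F'(x) z, z\<rangle> \<ge> -f'(\<parallel>x - x*\<parallel>) \<parallel>z\<parallel>\<^sup>2\<close>. So while \<open>f' < 0\<close> each Newton
  inclusion has a strongly monotone linear part and, by Minty's theorem and Banach's fixed point
  theorem, exactly one solution. Comparing the inclusion with \<open>0 \<in> F(x*) + T(x*)\<close> by monotonicity
  of \<open>T\<close> bounds the new error by \<open>n(s) = f(s)/f'(s) - s\<close>, where \<open>s\<close> is the old error, and convexity
  of \<open>f'\<close> makes \<open>n(s)/s\<^sup>2\<close> increasing; this yields both the quadratic rate and the comparison with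
  the scalar sequence. The same comparison at another zero \<open>y\<close> gives \<open>f(\<parallel>y - x*\<parallel>) \<ge> 0\<close>, hence
  uniqueness. The radius is attained on the real line by the odd extension of \<open>-f\<close> with \<open>T = 0\<close>,
  for which Newton's method cycles between \<open>\<rho>\<close> and \<open>-\<rho>\<close>.
\<close>

section \<open>Monotone inclusions in a Hilbert space\<close>

text \<open>Minimizing sequences for c + |p|^2/2 over \<open>D\<close> are Cauchy in p by the
  parallelogram law, and then c converges because the values do. The final inequality is the
  first-order condition at the minimizer.\<close>

lemma quadratic_minimizer:
  fixes D :: "('b::{real_inner,complete_space} \<times> real) set"
  assumes cl: "closed D" and cv: "convex D" and ne: "D \<noteq> {}"
    and bdd: "\<And>p c. (p, c) \<in> D \<Longrightarrow> B \<le> c + (norm p)\<^sup>2 / 2"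
  obtains a \<gamma> where "(a, \<gamma>) \<in> D" "\<And>p c. (p, c) \<in> D \<Longrightarrow> \<gamma> + a \<bullet> (a - p) \<le> c"
proof -
  define val where "val q = snd q + (norm (fst q))\<^sup>2 / 2" for q :: "'b \<times> real"
  define m where "m = Inf (val ` D)"
  have bb: "bdd_below (val ` D)"
    unfolding bdd_below_def val_def using bdd by (intro exI[of _ B]) auto
  have m_le: "m \<le> val q" if "q \<in> D" for q
    unfolding m_def using bb that by (simp add: cInf_lower)
  have "\<exists>q\<in>D. val q < m + inverse (real (Suc n))" for n
  proof -
    have "Inf (val ` D) < m + inverse (real (Suc n))"
      unfolding m_def using positive_imp_inverse_positive[of "real (Suc n)"] by linarith
    then show ?thesis
      using cInf_lessD[of "val ` D"] ne by auto
  qed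
  then obtain q where qD: "\<And>n. q n \<in> D" and q: "\<And>n. val (q n) < m + inverse (real (Suc n))"
    by metis
  \<comment> \<open>The parallelogram law at the midpoint, whose value is at least
    \<open>m\<close>.\<close>
  have mid: "(norm (fst x - fst y))\<^sup>2 \<le> 4 * val x + 4 * val y - 8 * m" if "x \<in> D" "y \<in> D" for x y
  proof -
    have "(1/2) *\<^sub>R x + (1/2) *\<^sub>R y \<in> D"
      using cv that by (intro convexD) auto
    then have "m \<le> val ((1/2) *\<^sub>R x + (1/2) *\<^sub>R y)"
      by (rule m_le)
    also have "\<dots> = (val x + val y) / 2 - (norm (fst x - fst y))\<^sup>2 / 8"
      unfolding val_def power2_norm_eq_inner
      by (simp add: inner_simps inner_commute field_simps)
    finally show ?thesis by argo
  qed
  have lim_val: "(\<lambda>n. val (q n)) \<longlonglongrightarrow> m"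
  proof (rule tendsto_sandwich[of "\<lambda>_. m" _ _ "\<lambda>n. m + inverse (real (Suc n))"])
    show "(\<lambda>n. m + inverse (real (Suc n))) \<longlonglongrightarrow> m"
      using tendsto_add[OF tendsto_const LIMSEQ_inverse_real_of_nat, of m] by simp
  qed (use m_le qD q in \<open>auto intro!: always_eventually less_imp_le\<close>)
  have "Cauchy (\<lambda>n. fst (q n))"
  proof (rule CauchyI)
    fix e :: real assume e: "0 < e"
    have "\<forall>\<^sub>F n in sequentially. val (q n) < m + e\<^sup>2 / 8"
      using lim_val e by (intro order_tendstoD) auto
    then obtain N where N: "\<And>n. N \<le> n \<Longrightarrow> val (q n) < m + e\<^sup>2 / 8"
      by (auto simp: eventually_sequentially)
    have "norm (fst (q i) - fst (q j)) < e" if "N \<le> i" "N \<le> j" for i j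
    proof -
      have "(norm (fst (q i) - fst (q j)))\<^sup>2 < e\<^sup>2"
        using mid[OF qD qD, of i j] N[OF that(1)] N[OF that(2)] by argo
      then show ?thesis using e by (simp add: power2_less_imp_less)
    qed
    then show "\<exists>M. \<forall>m\<ge>M. \<forall>n\<ge>M. norm (fst (q m) - fst (q n)) < e" by blast
  qed
  then obtain a where a: "(\<lambda>n. fst (q n)) \<longlonglongrightarrow> a"
    using Cauchy_convergent convergent_def by blast
  define \<gamma> where "\<gamma> = m - (norm a)\<^sup>2 / 2"
  have "(\<lambda>n. val (q n) - (norm (fst (q n)))\<^sup>2 / 2) \<longlonglongrightarrow> \<gamma>"
    unfolding \<gamma>_def by (intro tendsto_intros lim_val a) simp_all
  then have "(\<lambda>n. snd (q n)) \<longlonglongrightarrow> \<gamma>"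
    by (simp add: val_def)
  then have "(\<lambda>n. (fst (q n), snd (q n))) \<longlonglongrightarrow> (a, \<gamma>)"
    by (intro tendsto_Pair a)
  then have aD: "(a, \<gamma>) \<in> D"
    using closed_sequentially[OF cl, of q "(a, \<gamma>)"] qD by simp
  moreover have "\<gamma> + a \<bullet> (a - p) \<le> c" if pD: "(p, c) \<in> D" for p c
  proof -
    \<comment> \<open>The excess of the value at a point of the segment towards
      \<open>(p, c)\<close>, divided by \<open>t\<close>; letting \<open>t\<close> tend to 0 removes
      the quadratic term.\<close>
    have "0 \<le> (c - \<gamma> + a \<bullet> (p - a)) + t * ((norm (p - a))\<^sup>2 / 2)" if t: "0 < t" "t < 1" for t
    proof -
      have "(1 - t) *\<^sub>R (a, \<gamma>) + t *\<^sub>R (p, c) \<in> D"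
        using cv aD pD t by (intro convexD) auto
      then have "m \<le> val ((1 - t) *\<^sub>R (a, \<gamma>) + t *\<^sub>R (p, c))"
        by (rule m_le)
      then have "0 \<le> t * (c - \<gamma> + a \<bullet> (p - a)) + t * (t * ((norm (p - a))\<^sup>2 / 2))"
        unfolding val_def \<gamma>_def power2_norm_eq_inner
        by (simp add: inner_simps inner_commute field_simps)
      then have "0 \<le> t * ((c - \<gamma> + a \<bullet> (p - a)) + t * ((norm (p - a))\<^sup>2 / 2))"
        by (simp add: algebra_simps)
      then show ?thesis using t by (simp add: zero_le_mult_iff)
    qed
    then have "\<forall>\<^sub>F t in at_right 0. 0 \<le> (c - \<gamma> + a \<bullet> (p - a)) + t * ((norm (p - a))\<^sup>2 / 2)"
      by (auto simp: eventually_at_right_field intro!: exI[of _ 1])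
    moreover have "((\<lambda>t. (c - \<gamma> + a \<bullet> (p - a)) + t * ((norm (p - a))\<^sup>2 / 2)) \<longlongrightarrow>
        (c - \<gamma> + a \<bullet> (p - a)) + 0 * ((norm (p - a))\<^sup>2 / 2)) (at_right 0)"
      by (intro tendsto_intros)
    ultimately have "0 \<le> c - \<gamma> + a \<bullet> (p - a)"
      using tendsto_lowerbound by fastforce
    then show ?thesis by (simp add: inner_simps)
  qed
  ultimately show ?thesis using that by blast
qed

lemma maximal_monotoneD:
  assumes "maximal_monotone_op T" "\<And>y v. v \<in> T y \<Longrightarrow> 0 \<le> (u - v) \<bullet> (x - y)"
  shows "u \<in> T x"
  using assms unfolding maximal_monotone_op_def by blast

lemma monotoneD:
  assumes "maximal_monotone_op T" "u \<in> T y" "v \<in> T x"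
  shows "0 \<le> (u - v) \<bullet> (y - x)"
  using assms unfolding maximal_monotone_op_def monotone_op_def by blast

text \<open>Minty's theorem at \<open>0\<close>. The set \<open>D\<close> is the epigraph of the Fitzpatrick function of \<open>T\<close>,
  which dominates the duality pairing by maximality. At the minimizer \<open>(x, s)\<close> of this function
  plus half the squared norm, the first-order condition puts \<open>(-s, -x)\<close> in the graph of \<open>T\<close>, and
  testing it with that same point forces \<open>s = -x\<close>.\<close>

lemma minty_zero:
  fixes T :: "'a::{real_inner,complete_space} \<Rightarrow> 'a set"
  assumes T: "maximal_monotone_op T"
  obtains x where "- x \<in> T x"
proof -
  define D where "D = {((x, s), c :: real). \<forall>y. \<forall>v\<in>T y. x \<bullet> v + s \<bullet> y - y \<bullet> v \<le> c}"
  have D_iff: "((x, s), c) \<in> D \<longleftrightarrow> (\<forall>y. \<forall>v\<in>T y. x \<bullet> v + s \<bullet> y - y \<bullet> v \<le> c)" for x s c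
    by (simp add: D_def)
  have D_eq: "D = (\<Inter>y. \<Inter>v\<in>T y. {w. fst (fst w) \<bullet> v + snd (fst w) \<bullet> y - y \<bullet> v \<le> snd w})"
    by (auto simp: D_def)
  have cl: "closed D"
    unfolding D_eq by (intro closed_INT ballI closed_Collect_le continuous_intros)
  have cv: "convex D"
  proof (rule convexI)
    fix w w' and \<alpha> \<beta> :: real
    assume w: "w \<in> D" "w' \<in> D" and ab: "0 \<le> \<alpha>" "0 \<le> \<beta>" "\<alpha> + \<beta> = 1"
    have "fst (fst (\<alpha> *\<^sub>R w + \<beta> *\<^sub>R w')) \<bullet> v + snd (fst (\<alpha> *\<^sub>R w + \<beta> *\<^sub>R w')) \<bullet> y - y \<bullet> v
        \<le> snd (\<alpha> *\<^sub>R w + \<beta> *\<^sub>R w')" if v: "v \<in> T y" for y v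
    proof -
      have "fst (fst w) \<bullet> v + snd (fst w) \<bullet> y - y \<bullet> v \<le> snd w"
        "fst (fst w') \<bullet> v + snd (fst w') \<bullet> y - y \<bullet> v \<le> snd w'"
        using w v by (auto simp: D_eq)
      then have "\<alpha> * (fst (fst w) \<bullet> v + snd (fst w) \<bullet> y - y \<bullet> v) +
          \<beta> * (fst (fst w') \<bullet> v + snd (fst w') \<bullet> y - y \<bullet> v) \<le> \<alpha> * snd w + \<beta> * snd w'"
        using ab by (intro add_mono mult_left_mono)
      moreover have "y \<bullet> v = \<alpha> * (y \<bullet> v) + \<beta> * (y \<bullet> v)"
        using ab(3) by (simp flip: distrib_right)
      ultimately show ?thesis by (simp add: inner_simps algebra_simps)
    qed
    then show "\<alpha> *\<^sub>R w + \<beta> *\<^sub>R w' \<in> D" by (auto simp: D_eq)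
  qed
  \<comment> \<open>With an empty graph the maximality test would be vacuous and would put every
    vector into the graph.\<close>
  obtain y0 v0 where 0: "v0 \<in> T y0"
    using maximal_monotoneD[OF T] by blast
  have graph: "((y, v), y \<bullet> v) \<in> D" if "v \<in> T y" for y v
    using monotoneD[OF T that] by (fastforce simp: D_iff inner_simps inner_commute)
  \<comment> \<open>If c were below the pairing, maximality would put \<open>(x, s)\<close> into the
    graph, and testing the epigraph condition at this very pair gives the contradiction.\<close>
  have lower: "x \<bullet> s \<le> c" if "((x, s), c) \<in> D" for x s c
  proof (rule ccontr)
    assume neg: "\<not> x \<bullet> s \<le> c"
    have "0 \<le> (s - v) \<bullet> (x - y)" if "v \<in> T y" for y v
    proof -
      have "x \<bullet> v + s \<bullet> y - y \<bullet> v \<le> c" using \<open>((x, s), c) \<in> D\<close> that by (simp add: D_iff)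
      then show ?thesis using neg by (simp add: inner_simps inner_commute)
    qed
    then have "s \<in> T x" by (rule maximal_monotoneD[OF T])
    then have "x \<bullet> s + s \<bullet> x - x \<bullet> s \<le> c" using that unfolding D_iff by blast
    then show False using neg by (simp add: inner_commute)
  qed
  have bdd: "0 \<le> c + (norm p)\<^sup>2 / 2" if "(p, c) \<in> D" for p c
  proof -
    obtain x s where p: "p = (x, s)" by (cases p)
    have "0 \<le> (norm (x + s))\<^sup>2 / 2" by simp
    also have "\<dots> = x \<bullet> s + (norm p)\<^sup>2 / 2"
      unfolding power2_norm_eq_inner p by (simp add: inner_simps inner_commute field_simps)
    also have "\<dots> \<le> c + (norm p)\<^sup>2 / 2" using lower that p by simp
    finally show ?thesis .
  qed
  obtain a \<gamma> where aD: "(a, \<gamma>) \<in> D" and a: "\<And>p c. (p, c) \<in> D \<Longrightarrow> \<gamma> + a \<bullet> (a - p) \<le> c"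
    using quadratic_minimizer[OF cl cv _ bdd] graph[OF 0] by blast
  obtain x s where xs: "a = (x, s)" by (cases a)
  have key: "(norm (x + s))\<^sup>2 \<le> (- x - v) \<bullet> (- s - y)" if "v \<in> T y" for y v
    using a[OF graph[OF that]] lower[of x s \<gamma>] aD
    unfolding xs power2_norm_eq_inner by (simp add: inner_simps inner_commute)
  then have "0 \<le> (- x - v) \<bullet> (- s - y)" if "v \<in> T y" for y v
    using that order_trans zero_le_power2 by blast
  then have "- x \<in> T (- s)" by (rule maximal_monotoneD[OF T])
  moreover from key[OF this] have "x + s = 0" by simp
  then have "- s = x" by (simp add: add_eq_0_iff2)
  ultimately show ?thesis using that by simp
qed

text \<open>Allows Minty's theorem at \<open>0\<close> to be applied to \<open>l T - w\<close>,
  which yields the resolvent of \<open>T\<close> at every \<open>w\<close>. Maximality is pulled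
  back through the inverse affine map on values.\<close>

lemma maximal_monotone_scale_shift:
  assumes T: "maximal_monotone_op T" and l: "0 < (l::real)"
  shows "maximal_monotone_op (\<lambda>x. (\<lambda>v. l *\<^sub>R v + b) ` T x)"
proof -
  have mono: "monotone_op (\<lambda>x. (\<lambda>v. l *\<^sub>R v + b) ` T x)"
    unfolding monotone_op_def
  proof (clarsimp)
    fix x y u v assume "u \<in> T y" "v \<in> T x"
    then have "0 \<le> l * ((u - v) \<bullet> (y - x))" using monotoneD[OF T] l by simp
    then show "0 \<le> (l *\<^sub>R u - l *\<^sub>R v) \<bullet> (y - x)" by (simp flip: scaleR_diff_right)
  qed
  have "u \<in> (\<lambda>v. l *\<^sub>R v + b) ` T x"
    if h: "\<And>y v. v \<in> T y \<Longrightarrow> 0 \<le> (u - (l *\<^sub>R v + b)) \<bullet> (x - y)" for x u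
  proof -
    have "(1 / l) *\<^sub>R (u - b) \<in> T x"
    proof (rule maximal_monotoneD[OF T])
      fix y v assume "v \<in> T y"
      then have "0 \<le> (1 / l) * ((u - (l *\<^sub>R v + b)) \<bullet> (x - y))"
        using h l by (intro mult_nonneg_nonneg) auto
      also have "\<dots> = ((1 / l) *\<^sub>R (u - b) - v) \<bullet> (x - y)"
        using l by (simp add: inner_simps field_simps)
      finally show "0 \<le> ((1 / l) *\<^sub>R (u - b) - v) \<bullet> (x - y)" .
    qed
    then show ?thesis using l by (intro image_eqI[of _ _ "(1 / l) *\<^sub>R (u - b)"]) auto
  qed
  then show ?thesis
    using mono unfolding maximal_monotone_op_def set_dom_def by blast
qed

text \<open>Inclusion \<open>0 \<in> A y + b + T y\<close>: a solution is a fixed point of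
  \<open>z \<mapsto> J (z - l (A z + b))\<close> with \<open>J = (I + l T)\<^sup>-\<^sup>1\<close>, a contraction for small \<open>l\<close>.\<close>

lemma strongly_monotone_inclusion:
  fixes T :: "'a::{real_inner,complete_space} \<Rightarrow> 'a set" and A :: "'a \<Rightarrow>\<^sub>L 'a"
  assumes T: "maximal_monotone_op T" and m: "0 < m"
    and A: "\<And>z. m * (norm z)\<^sup>2 \<le> A z \<bullet> z"
  shows "\<exists>!y. - (A y + b) \<in> T y"
proof (rule ex_ex1I)
  define M where "M = norm A"
  \<comment> \<open>This choice gives \<open>l\<^sup>2 * M\<^sup>2 \<le> l * m \<le> 1\<close>, so
    the squared contraction factor 1 - 2lm + l^2 M^2 is at most 1 - lm. The summand
    \<open>m\<^sup>2\<close> keeps the denominator positive also when \<open>M = 0\<close>.\<close>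
  define l where "l = m / (m\<^sup>2 + M\<^sup>2)"
  have pos: "0 < m\<^sup>2 + M\<^sup>2" using m by (simp add: add_pos_nonneg)
  have l: "0 < l" unfolding l_def using m pos by simp
  define q where "q = sqrt (1 - l * m)"
  have lm: "l * (m\<^sup>2 + M\<^sup>2) = m" using pos by (simp add: l_def)
  have lM: "l\<^sup>2 * M\<^sup>2 \<le> l * m"
  proof -
    have "0 \<le> l * m\<^sup>2" using l by simp
    then have "l * M\<^sup>2 \<le> m" using lm unfolding distrib_left by linarith
    then have "l * (l * M\<^sup>2) \<le> l * m" using l by (intro mult_left_mono) auto
    then show ?thesis by (simp add: power2_eq_square mult_ac)
  qed
  have lm1: "l * m \<le> 1"
    unfolding l_def using pos by (simp add: field_simps power2_eq_square)
  have q: "0 \<le> q" "q < 1" using lm1 l m by (auto simp: q_def)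
  have contr: "norm (z - l *\<^sub>R A z) \<le> q * norm z" for z
  proof -
    have "(norm (z - l *\<^sub>R A z))\<^sup>2 = (norm z)\<^sup>2 - 2 * l * (A z \<bullet> z) + l\<^sup>2 * (norm (A z))\<^sup>2"
      unfolding power2_norm_eq_inner
      by (simp add: inner_simps inner_commute power2_eq_square algebra_simps)
    also have "\<dots> \<le> (norm z)\<^sup>2 - 2 * l * (m * (norm z)\<^sup>2) + l\<^sup>2 * (M * norm z)\<^sup>2"
      using l A[of z] norm_blinfun[of A z]
      by (intro add_mono diff_mono mult_left_mono power_mono) (auto simp: M_def)
    also have "\<dots> = (1 - 2 * (l * m) + l\<^sup>2 * M\<^sup>2) * (norm z)\<^sup>2"
      by (simp add: algebra_simps power_mult_distrib)
    also have "\<dots> \<le> (1 - l * m) * (norm z)\<^sup>2"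
      using lM by (intro mult_right_mono) auto
    also have "\<dots> = (q * norm z)\<^sup>2"
      using lm1 by (simp add: q_def power_mult_distrib)
    finally show ?thesis
      by (rule power2_le_imp_le) (simp add: q)
  qed
  have "\<exists>y. w - y \<in> (\<lambda>v. l *\<^sub>R v) ` T y" for w
  proof -
    obtain y where "- y \<in> (\<lambda>v. l *\<^sub>R v + (- w)) ` T y"
      using minty_zero[OF maximal_monotone_scale_shift[OF T l]] by blast
    then show ?thesis by (force simp: algebra_simps)
  qed
  then obtain J where J: "\<And>w. w - J w \<in> (\<lambda>v. l *\<^sub>R v) ` T (J w)" by metis
  \<comment> \<open>Monotonicity makes the resolvent firmly nonexpansive; Cauchy-Schwarz then gives
    nonexpansiveness.\<close>
  have Jne: "norm (J w - J w') \<le> norm (w - w')" for w w'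
  proof -
    obtain v v' where v: "v \<in> T (J w)" "w - J w = l *\<^sub>R v" "v' \<in> T (J w')" "w' - J w' = l *\<^sub>R v'"
      using J[of w] J[of w'] by auto
    have "0 \<le> l * ((v - v') \<bullet> (J w - J w'))" using monotoneD[OF T v(1,3)] l by simp
    also have "\<dots> = ((w - J w) - (w' - J w')) \<bullet> (J w - J w')"
      unfolding v by (simp flip: scaleR_diff_right)
    finally have "(norm (J w - J w'))\<^sup>2 \<le> (w - w') \<bullet> (J w - J w')"
      unfolding power2_norm_eq_inner by (simp add: inner_simps)
    also have "\<dots> \<le> norm (w - w') * norm (J w - J w')" by (rule norm_cauchy_schwarz)
    finally show ?thesis
      by (cases "norm (J w - J w') = 0") (auto simp: power2_eq_square)
  qed
  have "\<exists>!y. J (y - l *\<^sub>R (A y + b)) = y"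
  proof (rule banach_fix_type[OF q], intro allI)
    fix y z
    have "norm (J (y - l *\<^sub>R (A y + b)) - J (z - l *\<^sub>R (A z + b))) \<le> norm ((y - z) - l *\<^sub>R A (y - z))"
      using Jne[of "y - l *\<^sub>R (A y + b)" "z - l *\<^sub>R (A z + b)"]
      by (simp add: blinfun.diff_right algebra_simps)
    also have "\<dots> \<le> q * norm (y - z)" by (rule contr)
    finally show "dist (J (y - l *\<^sub>R (A y + b))) (J (z - l *\<^sub>R (A z + b))) \<le> q * dist y z"
      by (simp add: dist_norm)
  qed
  then obtain y where y: "J (y - l *\<^sub>R (A y + b)) = y" by blast
  from J[of "y - l *\<^sub>R (A y + b)"] obtain v where "v \<in> T y" "l *\<^sub>R v = - (l *\<^sub>R (A y + b))"
    unfolding y by (auto simp: algebra_simps)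
  moreover from this(2) have "v = - (A y + b)"
    using l by (metis scaleR_cancel_left less_irrefl scaleR_minus_right)
  ultimately show "\<exists>y. - (A y + b) \<in> T y" by blast
next
  fix y z assume "- (A y + b) \<in> T y" "- (A z + b) \<in> T z"
  from monotoneD[OF T this] have "A (y - z) \<bullet> (y - z) \<le> 0"
    by (simp add: blinfun.diff_right inner_simps)
  with A[of "y - z"] have "m * (norm (y - z))\<^sup>2 \<le> 0" by linarith
  then show "y = z" using m by (simp add: mult_le_0_iff)
qed

section \<open>The scalar majorant\<close>

lemma less_SupE:
  fixes t :: real
  assumes "t < Sup S" "S \<noteq> {}"
  obtains s where "s \<in> S" "t < s"
  using less_cSupE[OF assms] by blast

lemma strict_antimono_onI_Suc:
  fixes u :: "nat \<Rightarrow> real"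
  assumes "\<And>k. u (Suc k) < u k"
  shows "strict_antimono_on UNIV u"
  using lift_Suc_mono_less[of "\<lambda>k. - u k"] assms by (auto simp: monotone_on_def)

context
  fixes R :: real and f f' f'' :: "real \<Rightarrow> real"
  assumes R: "0 < R" and majorant: "majorant_function R f f' f''"
begin

lemma f_within: "t \<in> {0..<R} \<Longrightarrow> (f has_real_derivative f' t) (at t within {0..<R})"
  and f'_within: "t \<in> {0..<R} \<Longrightarrow> (f' has_real_derivative f'' t) (at t within {0..<R})"
  and f_0: "f 0 = 0" and f'_0: "f' 0 = -1"
  and f'_convex: "convex_on {0..<R} f'"
  using majorant unfolding majorant_function_def by auto

lemma f'_less: "0 \<le> a \<Longrightarrow> a < b \<Longrightarrow> b < R \<Longrightarrow> f' a < f' b"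
  using majorant unfolding majorant_function_def strict_mono_on_def by auto

lemma f'_le: "0 \<le> a \<Longrightarrow> a \<le> b \<Longrightarrow> b < R \<Longrightarrow> f' a \<le> f' b"
  using f'_less[of a b] by (cases "a = b") auto

lemma continuous_on_f:
  assumes "A \<subseteq> {0..<R}"
  shows "continuous_on A f" "continuous_on A f'"
proof -
  have "continuous_on {0..<R} f" "continuous_on {0..<R} f'"
    using f_within f'_within by (blast intro: DERIV_continuous_on)+
  then show "continuous_on A f" "continuous_on A f'"
    using assms continuous_on_subset by blast+
qed

lemma DERIV_f:
  assumes "0 < t" "t < R"
  shows "(f has_real_derivative f' t) (at t)" "(f' has_real_derivative f'' t) (at t)"
proof -
  have "at t within {0..<R} = at t"
    using assms by (intro at_within_interior) auto
  then show "(f has_real_derivative f' t) (at t)" "(f' has_real_derivative f'' t) (at t)"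
    using f_within[of t] f'_within[of t] assms by auto
qed

section \<open>Consequences of monotonicity and convexity of \<open>f'\<close>\<close>

text \<open>With \<open>t\<close> frozen, \<open>u * f' t - f u\<close> vanishes at
  \<open>u = 0\<close> and has derivative \<open>f' t - f' u > 0\<close> on (0,t).\<close>

lemma majorant_excess_pos:
  assumes "0 < t" "t < R"
  shows "0 < t * f' t - f t"
proof -
  have "0 * f' t - f 0 < t * f' t - f t"
  proof (rule DERIV_pos_imp_increasing_open[OF assms(1)])
    fix u assume u: "0 < u" "u < t"
    have "((\<lambda>u. u * f' t - f u) has_real_derivative f' t - f' u) (at u)"
      using u assms by (auto intro!: derivative_eq_intros DERIV_f)
    then show "\<exists>y. ((\<lambda>u. u * f' t - f u) has_real_derivative y) (at u) \<and> 0 < y"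
      using f'_less[of u t] u assms by auto
  qed (use assms in \<open>auto intro!: continuous_intros continuous_on_f\<close>)
  then show ?thesis by (simp add: f_0)
qed

text \<open>A convex \<open>f'\<close> lies above its tangent at \<open>t\<close>; integrating this
  over [0,t] gives the estimate. \<open>\<psi>\<close> is the integrated difference.\<close>

lemma majorant_excess_le:
  assumes "0 < t" "t < R"
  shows "2 * (t * f' t - f t) \<le> t\<^sup>2 * f'' t"
proof -
  have tangent: "f' t - f' u \<le> f'' t * (t - u)" if "0 < u" "u < t" for u
  proof -
    have "f'' t * (u - t) \<le> f' u - f' t"
      using that assms by (intro convex_on_imp_above_tangent[OF f'_convex] f'_within) auto
    then show ?thesis by (simp add: algebra_simps)
  qed
  define \<psi> where "\<psi> u = f'' t * (t * u - u\<^sup>2 / 2) - (u * f' t - f u)" for u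
  have "\<psi> 0 \<le> \<psi> t"
  proof (rule DERIV_nonneg_imp_increasing_open[of 0 t \<psi>])
    fix u assume u: "0 < u" "u < t"
    have "(\<psi> has_real_derivative f'' t * (t - u) - (f' t - f' u)) (at u)"
      unfolding \<psi>_def using u assms by (auto intro!: derivative_eq_intros DERIV_f)
    then show "\<exists>y. (\<psi> has_real_derivative y) (at u) \<and> 0 \<le> y"
      using tangent[OF u] by auto
  qed (use assms in \<open>auto simp: \<psi>_def intro!: continuous_intros continuous_on_f\<close>)
  then show ?thesis
    by (simp add: \<psi>_def f_0 power2_eq_square algebra_simps)
qed

text \<open>Up to a positive factor, the derivative of the quotient is the difference of the two
  sides of \<open>majorant_excess_le\<close>.\<close>

lemma majorant_excess_ratio_mono:
  assumes "0 < a" "a \<le> b" "b < R"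
  shows "(a * f' a - f a) / a\<^sup>2 \<le> (b * f' b - f b) / b\<^sup>2"
proof (rule DERIV_nonneg_imp_nondecreasing[OF assms(2)])
  fix t assume "a \<le> t" "t \<le> b"
  then have t: "0 < t" "t < R" using assms by auto
  have "((\<lambda>t. (t * f' t - f t) / t\<^sup>2) has_real_derivative
      ((t * f'' t) * t\<^sup>2 - (t * f' t - f t) * (2 * t)) / (t\<^sup>2 * t\<^sup>2)) (at t)"
    using t by (auto intro!: derivative_eq_intros DERIV_f)
  moreover have "0 \<le> t * (t\<^sup>2 * f'' t - 2 * (t * f' t - f t))"
    using majorant_excess_le[OF t] t by (intro mult_nonneg_nonneg) auto
  then have "0 \<le> ((t * f'' t) * t\<^sup>2 - (t * f' t - f t) * (2 * t)) / (t\<^sup>2 * t\<^sup>2)"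
    by (simp add: algebra_simps)
  ultimately show "\<exists>y. ((\<lambda>t. (t * f' t - f t) / t\<^sup>2) has_real_derivative y) (at t) \<and> 0 \<le> y"
    by blast
qed

text \<open>The quotient rule leaves the positive excess \<open>t * f' t - f t\<close>. As a
  consequence, \<open>f\<close> is negative to the left of any point where it is negative, which is
  how uniqueness up to \<open>\<sigma>\<close> is obtained.\<close>

lemma majorant_slope_mono:
  assumes "0 < a" "a \<le> b" "b < R"
  shows "f a / a \<le> f b / b"
proof (rule DERIV_nonneg_imp_nondecreasing[OF assms(2)])
  fix t assume "a \<le> t" "t \<le> b"
  then have t: "0 < t" "t < R" using assms by auto
  have "((\<lambda>t. f t / t) has_real_derivative (f' t * t - f t * 1) / (t * t)) (at t)"
    using t by (auto intro!: derivative_eq_intros DERIV_f)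
  moreover have "0 \<le> (f' t * t - f t * 1) / (t * t)"
    using majorant_excess_pos[OF t] t by (simp add: mult.commute)
  ultimately show "\<exists>y. ((\<lambda>t. f t / t) has_real_derivative y) (at t) \<and> 0 \<le> y"
    by blast
qed

text \<open>\<open>f u + u\<close> is increasing, since \<open>f'\<close> exceeds its initial value
  -1.\<close>

lemma majorant_ge_neg:
  assumes "0 < t" "t < R"
  shows "- t < f t"
proof -
  have "f 0 + 0 < f t + t"
  proof (rule DERIV_pos_imp_increasing_open[OF assms(1)])
    fix u assume u: "0 < u" "u < t"
    have "((\<lambda>u. f u + u) has_real_derivative f' u + 1) (at u)"
      using u assms by (auto intro!: derivative_eq_intros DERIV_f)
    then show "\<exists>y. ((\<lambda>u. f u + u) has_real_derivative y) (at u) \<and> 0 < y"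
      using f'_less[of 0 u] u assms f'_0 by (intro exI[of _ "f' u + 1"]) auto
  qed (use assms in \<open>auto intro!: continuous_intros continuous_on_f\<close>)
  then show ?thesis by (simp add: f_0)
qed

lemma f'_small_near_0:
  assumes "-1 < c"
  obtains d where "0 < d" "d < R" "\<And>t. 0 \<le> t \<Longrightarrow> t \<le> d \<Longrightarrow> f' t < c"
proof -
  have "((f' \<longlongrightarrow> f' 0) (at 0 within {0..<R}))"
    using continuous_on_f(2)[of "{0..<R}"] R by (auto simp: continuous_on_def)
  then have "\<forall>\<^sub>F t in at 0 within {0..<R}. f' t < c"
    using assms f'_0 by (intro order_tendstoD) auto
  then obtain d where d: "0 < d" "\<And>t. t \<in> {0..<R} \<Longrightarrow> t \<noteq> 0 \<Longrightarrow> \<bar>t\<bar> < d \<Longrightarrow> f' t < c"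
    by (auto simp: eventually_at dist_real_def)
  have "f' t < c" if "0 \<le> t" "t \<le> min d R / 2" for t
    using d that assms f'_0 R by (cases "t = 0") auto
  then show thesis using d(1) R by (intro that[of "min d R / 2"]) auto
qed

text \<open>Below, \<open>f t / f' t - t\<close> is the next term \<open>\<bar>t - f t / f' t\<bar>\<close> of the
  majorant sequence; it equals \<open>(t * f' t - f t) / \<bar>f' t\<bar>\<close>.\<close>

lemma newton_map_pos:
  assumes "0 < t" "t < R" "f' t < 0"
  shows "0 < f t / f' t - t"
proof -
  have "f t / f' t - t = (t * f' t - f t) / (- f' t)" using assms by (simp add: field_simps)
  then show ?thesis using majorant_excess_pos[OF assms(1,2)] assms(3) by (simp only: divide_pos_pos)
qed

text \<open>The numerator, excess over the square, is nondecreasing, and the positive denominator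
  \<open>- f'\<close> strictly decreases; strictness comes from the latter.\<close>

lemma newton_map_ratio_less:
  assumes "0 < a" "a < b" "b < R" "f' b < 0"
  shows "(f a / f' a - a) / a\<^sup>2 < (f b / f' b - b) / b\<^sup>2"
proof -
  have ab: "f' a < f' b" using assms by (intro f'_less) auto
  have eq: "(f t / f' t - t) / t\<^sup>2 = (t * f' t - f t) / t\<^sup>2 / (- f' t)" if "f' t < 0" "0 < t" for t
    using that by (simp add: field_simps)
  have "(a * f' a - f a) / a\<^sup>2 / (- f' a) \<le> (b * f' b - f b) / b\<^sup>2 / (- f' a)"
    using assms ab by (intro divide_right_mono majorant_excess_ratio_mono) auto
  also have "\<dots> < (b * f' b - f b) / b\<^sup>2 / (- f' b)"
    using assms ab majorant_excess_pos[of b] by (intro divide_strict_left_mono) (auto simp: mult_neg_neg)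
  finally show ?thesis using assms ab by (simp add: eq)
qed

lemma newton_map_ratio_le:
  assumes "0 < t" "t < R" "f' t < 0"
  shows "(f t / f' t - t) / t\<^sup>2 \<le> f'' t / (2 * \<bar>f' t\<bar>)"
proof -
  have "(f t / f' t - t) / t\<^sup>2 = (2 * (t * f' t - f t)) / (2 * t\<^sup>2 * (- f' t))"
    using assms by (simp add: field_simps)
  also have "\<dots> \<le> (t\<^sup>2 * f'' t) / (2 * t\<^sup>2 * (- f' t))"
    using assms majorant_excess_le[of t] by (intro divide_right_mono) (auto intro: mult_nonneg_nonpos mult_nonpos_nonneg)
  also have "\<dots> = f'' t / (2 * \<bar>f' t\<bar>)"
    using assms by simp
  finally show ?thesis .
qed

section \<open>The radii \<open>\<nu>\<close> and \<open>\<rho>\<close>\<close>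

context
  fixes \<nu> \<rho> :: real
  assumes \<nu>: "\<nu> = Sup {t\<in>{0..<R}. f' t < 0}"
    and \<rho>: "\<rho> = Sup {t\<in>{0<..<\<nu>}. f t / (t * f' t) - 1 < 1}"
begin

lemma below_nu:
  assumes "0 \<le> t" "t < \<nu>"
  shows "t < R" "f' t < 0"
proof -
  have "0 \<in> {t\<in>{0..<R}. f' t < 0}" using R f'_0 by auto
  then obtain s where "s \<in> {t\<in>{0..<R}. f' t < 0}" "t < s"
    using less_SupE[of t "{t\<in>{0..<R}. f' t < 0}"] assms(2) unfolding \<nu> by blast
  then show "t < R" "f' t < 0" using f'_less[of t s] assms by auto
qed

text \<open>Near 0, \<open>f' t < - 1 / 2\<close> and \<open>f t > - t\<close> give
  \<open>f t / (t * f' t) < 2\<close>, so the set defining \<open>\<rho>\<close> is nonempty. Its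
  condition passes from a point to all smaller ones because the Newton map over the square is
  increasing.\<close>

lemma
  shows rho_pos: "0 < \<rho>" and rho_le_nu: "\<rho> \<le> \<nu>"
    and below_rho: "\<And>t. 0 < t \<Longrightarrow> t < \<rho> \<Longrightarrow> f t / f' t - t < t"
proof -
  let ?S = "{t\<in>{0<..<\<nu>}. f t / (t * f' t) - 1 < 1}"
  obtain d where d: "0 < d" "d < R" "\<And>t. 0 \<le> t \<Longrightarrow> t \<le> d \<Longrightarrow> f' t < - 1 / 2"
    using f'_small_near_0[of "-1/2"] by auto
  have "d \<le> \<nu>" unfolding \<nu>
    using d(1,2) d(3)[of d] by (intro cSup_upper) (auto intro!: bdd_aboveI[of _ R])
  moreover define t where "t = d / 2"
  ultimately have t: "0 < t" "t < \<nu>" "f' t < - 1 / 2" using d(1) d(3)[of t] by auto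
  have "t < R" using below_nu[of t] t by simp
  have "2 * (t * f' t) < - t" using mult_strict_left_mono[OF t(3,1)] by simp
  also have "- t < f t" using majorant_ge_neg t \<open>t < R\<close> by blast
  finally have "f t / (t * f' t) < 2"
    using t by (simp add: neg_divide_less_eq mult_pos_neg)
  then have tS: "t \<in> ?S" using t by auto
  have bdd: "bdd_above ?S" by (auto intro!: bdd_aboveI[of _ \<nu>])
  show "0 < \<rho>" using cSup_upper[OF tS bdd] t unfolding \<rho> by linarith
  show "\<rho> \<le> \<nu>" unfolding \<rho> using tS by (intro cSup_least) auto
  fix u assume u: "0 < u" "u < \<rho>"
  then obtain s where s: "s \<in> ?S" "u < s"
    using less_SupE[of u ?S] tS unfolding \<rho> by blast
  have fs: "f' s < 0" "s < R" using below_nu[of s] s u by auto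
  \<comment> \<open>Chain: n(u)/u^2 < n(s)/s^2 < 1/s < 1/u for the Newton map n, where
    \<open>s\<close> is an element of the defining set beyond \<open>u\<close>.\<close>
  have "(f u / f' u - u) / u\<^sup>2 < (f s / f' s - s) / s\<^sup>2"
    using newton_map_ratio_less fs s u by blast
  also have "\<dots> = (f s / (s * f' s) - 1) / s"
    using s u fs by (simp add: field_simps power2_eq_square)
  also have "\<dots> \<le> 1 / s" using s u by (intro divide_right_mono) auto
  also have "\<dots> \<le> 1 / u" using s u by (simp add: frac_le)
  finally have "(f u / f' u - u) / u\<^sup>2 * u\<^sup>2 < 1 / u * u\<^sup>2"
    using u by (intro mult_strict_right_mono) auto
  then show "f u / f' u - u < u"
    using u by (simp add: power2_eq_square)
qed

section \<open>The majorant sequence\<close>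

context
  fixes r t0 :: real and t :: "nat \<Rightarrow> real"
  assumes r: "r \<le> \<rho>" and t0: "0 < t0" "t0 < r"
  defines "t \<equiv> rec_nat t0 (\<lambda>_ u. \<bar>u - f u / f' u\<bar>)"
begin

text \<open>On (0,r) the Newton map is positive and stays below its argument, so the absolute value
  only reverses the sign and the interval is invariant.\<close>

lemma majorant_seq_bounds: "0 < t k \<and> t k < r"
  and majorant_seq_Suc: "t (Suc k) = f (t k) / f' (t k) - t k"
  and majorant_seq_decr: "t (Suc k) < t k"
  and majorant_seq_below_nu: "t k < R \<and> f' (t k) < 0"
proof -
  have step: "u < R" "f' u < 0" "\<bar>u - f u / f' u\<bar> = f u / f' u - u" "0 < f u / f' u - u"
      "f u / f' u - u < u" if "0 < u" "u < r" for u
  proof -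
    show u: "u < R" "f' u < 0" using below_nu[of u] rho_le_nu r that by auto
    show "0 < f u / f' u - u" using newton_map_pos that u by blast
    then show "\<bar>u - f u / f' u\<bar> = f u / f' u - u" by linarith
    show "f u / f' u - u < u" using below_rho[of u] that r by simp
  qed
  have t_Suc: "t (Suc k) = \<bar>t k - f (t k) / f' (t k)\<bar>" for k by (simp add: t_def)
  have bounds: "0 < t k \<and> t k < r" for k
  proof (induction k)
    case 0 then show ?case using t0 by (simp add: t_def)
  next
    case (Suc k) then show ?case using step(3,4,5)[of "t k"] t_Suc by simp
  qed
  then show "0 < t k \<and> t k < r" "t (Suc k) = f (t k) / f' (t k) - t k" "t (Suc k) < t k"
    "t k < R \<and> f' (t k) < 0"
    using step[of "t k"] t_Suc by auto
qed

lemma majorant_seq_0: "t 0 = t0"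
  by (simp add: t_def)

lemma majorant_sequence_seq: "majorant_sequence R f f' t0 t"
  using majorant_seq_bounds majorant_seq_below_nu
  by (auto simp: majorant_sequence_def t_def less_imp_le less_imp_neq)

lemma majorant_seq_strict_antimono: "strict_antimono_on UNIV t"
  by (intro strict_antimono_onI_Suc majorant_seq_decr)

text \<open>The ratio is the increasing function n(t)/t^2 evaluated along a decreasing
  sequence.\<close>

lemma majorant_seq_ratio_strict_antimono: "strict_antimono_on UNIV (\<lambda>k. t (Suc k) / (t k)\<^sup>2)"
proof (rule strict_antimono_onI_Suc)
  fix k
  show "t (Suc (Suc k)) / (t (Suc k))\<^sup>2 < t (Suc k) / (t k)\<^sup>2"
    using newton_map_ratio_less[of "t (Suc k)" "t k"] majorant_seq_decr[of k]
      majorant_seq_bounds[of "Suc k"] majorant_seq_below_nu[of k]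
    by (simp only: majorant_seq_Suc[symmetric])
qed

lemma majorant_seq_ratio_le_0: "t (Suc k) / (t k)\<^sup>2 \<le> t 1 / t0\<^sup>2"
  using monotone_onD[OF majorant_seq_ratio_strict_antimono, of 0 k]
  by (cases "k = 0") (auto simp: majorant_seq_0)

lemma majorant_seq_ratio_bound: "t (Suc k) / (t k)\<^sup>2 \<le> f'' (t 0) / (2 * \<bar>f' (t 0)\<bar>)"
proof -
  have "t 1 / t0\<^sup>2 = (f t0 / f' t0 - t0) / t0\<^sup>2"
    using majorant_seq_Suc[of 0] by (simp add: majorant_seq_0)
  also have "\<dots> \<le> f'' t0 / (2 * \<bar>f' t0\<bar>)"
    using newton_map_ratio_le[of t0] majorant_seq_below_nu[of 0] t0 by (simp add: majorant_seq_0)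
  finally show ?thesis
    using majorant_seq_ratio_le_0[of k] by (simp add: majorant_seq_0)
qed

lemma majorant_seq_tendsto_0: "t \<longlonglongrightarrow> 0"
proof -
  \<comment> \<open>Since \<open>t (Suc k) / (t k)\<^sup>2\<close> is at most its first value and
    \<open>t k \<le> t0\<close>, every step contracts at least by the first factor
    \<open>q\<close>.\<close>
  define q where "q = t 1 / t0"
  have t1: "0 < t 1" "t 1 < t0"
    using majorant_seq_bounds[of 1] majorant_seq_decr[of 0] by (auto simp: majorant_seq_0)
  then have q: "0 \<le> q" "q < 1" using t0 by (auto simp: q_def)
  have bound: "t k \<le> q ^ k * t0" for k
  proof (induction k)
    case 0 then show ?case by (simp add: majorant_seq_0)
  next
    case (Suc k)
    have tk: "0 < t k" "t k \<le> t0"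
      using majorant_seq_bounds[of k] monotone_onD[OF majorant_seq_strict_antimono, of 0 k]
      by (cases "k = 0"; auto simp: majorant_seq_0)+
    have "t (Suc k) = t (Suc k) / (t k)\<^sup>2 * (t k)\<^sup>2" using tk by simp
    also have "\<dots> \<le> t 1 / t0\<^sup>2 * (t k)\<^sup>2"
      by (intro mult_right_mono majorant_seq_ratio_le_0) auto
    also have "\<dots> = (t 1 / t0\<^sup>2 * t k) * t k" by (simp add: power2_eq_square)
    also have "\<dots> \<le> (t 1 / t0\<^sup>2 * t0) * t k"
      using tk t1 by (intro mult_right_mono mult_left_mono) auto
    also have "\<dots> = q * t k" using t0 by (simp add: q_def power2_eq_square)
    also have "\<dots> \<le> q * (q ^ k * t0)" using Suc q by (intro mult_left_mono) auto
    finally show ?case by simp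
  qed
  have "(\<lambda>k. q ^ k * t0) \<longlonglongrightarrow> 0"
    using q by (intro tendsto_mult_left_zero LIMSEQ_realpow_zero) auto
  then show ?thesis
    using bound majorant_seq_bounds
    by (intro tendsto_sandwich[of "\<lambda>_. 0" t _ "\<lambda>k. q ^ k * t0"]) (auto simp: less_imp_le)
qed

end

end

end

section \<open>Majorized Newton steps\<close>

text \<open>Self-adjointness identifies \<open>G\<close> with its adjoint, so \<open>\<beta>\<close>
  below is the norm of the inverse of \<open>F' xs\<close> itself.\<close>

lemma hat_op_positive:
  assumes "positive_op G"
  shows "hat_op G = G"
proof -
  have "adjoint (blinfun_apply G) = blinfun_apply G"
    using assms by (intro adjoint_unique) (simp add: positive_op_def)
  then have "blinfun_adjoint G = G"
    by (simp add: blinfun_adjoint_def blinfun_apply_inverse)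
  then show ?thesis
    by (simp add: hat_op_def flip: scaleR_2)
qed

lemma inverse_op_eq:
  assumes "is_inverse_op A B"
  shows "inverse_op A = B"
  unfolding inverse_op_def
proof (rule the_equality[of "is_inverse_op A", OF assms])
  fix C assume "is_inverse_op A C"
  then have "C x = B x" for x
    using assms unfolding is_inverse_op_def
    by (metis blinfun_apply_blinfun_compose id_blinfun.rep_eq)
  then show "C = B" by (simp add: blinfun_eqI)
qed

text \<open>Positivity at \<open>x - s *\<^sub>R B x\<close> gives <G x, x> >= 2 s |x|^2 - s^2 <x, B
  x>, and \<open>s = 1 / norm B\<close> turns the right side into at least s |x|^2. No square root
  of \<open>G\<close> is involved.\<close>

lemma positive_op_coercive:
  fixes G B :: "'a::real_inner \<Rightarrow>\<^sub>L 'a"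
  assumes G: "positive_op G" and B: "is_inverse_op G B"
  shows "(norm x)\<^sup>2 \<le> norm B * (G x \<bullet> x)"
proof (cases "norm B = 0")
  \<comment> \<open>A zero inverse forces every vector to be 0.\<close>
  case True
  have "x = B (G x)"
    using B unfolding is_inverse_op_def by (metis blinfun_apply_blinfun_compose id_blinfun.rep_eq)
  then show ?thesis using True by simp
next
  case False
  define y where "y = B x"
  define s where "s = 1 / norm B"
  have Gy: "G y = x"
    using B unfolding is_inverse_op_def y_def
    by (metis blinfun_apply_blinfun_compose id_blinfun.rep_eq)
  have sym: "G x \<bullet> y = x \<bullet> x"
    using G Gy by (simp add: positive_op_def)
  have "x \<bullet> y \<le> norm x * (norm B * norm x)"
    unfolding y_def using norm_blinfun[of B x]
    by (intro order_trans[OF norm_cauchy_schwarz] mult_left_mono) auto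
  then have "s\<^sup>2 * (x \<bullet> y) \<le> s\<^sup>2 * (norm x * (norm B * norm x))"
    by (intro mult_left_mono) auto
  also have "\<dots> = s * (norm x)\<^sup>2"
    using False by (simp add: s_def power2_eq_square)
  finally have *: "s\<^sup>2 * (x \<bullet> y) \<le> s * (norm x)\<^sup>2" .
  have "0 \<le> G (x - s *\<^sub>R y) \<bullet> (x - s *\<^sub>R y)"
    using G unfolding positive_op_def by blast
  also have "\<dots> = G x \<bullet> x - 2 * (s * (norm x)\<^sup>2) + s\<^sup>2 * (x \<bullet> y)"
    unfolding power2_norm_eq_inner
    by (simp add: blinfun.diff_right blinfun.scaleR_right Gy inner_simps sym power2_eq_square algebra_simps)
  finally have "s * (norm x)\<^sup>2 \<le> G x \<bullet> x"
    using * by linarith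
  then have "norm B * (s * (norm x)\<^sup>2) \<le> norm B * (G x \<bullet> x)"
    by (intro mult_left_mono) auto
  then show ?thesis using False by (simp add: s_def)
qed

text \<open>The vector-valued mean value inequality along the segment, with \<open>\<phi>\<close> as
  scalar majorant. \<open>L\<close> is the operator of the linearization: the derivative at either
  endpoint in the two uses below.\<close>

lemma segment_error_bound:
  fixes F :: "'a::real_normed_vector \<Rightarrow> 'a" and F' :: "'a \<Rightarrow> 'a \<Rightarrow>\<^sub>L 'a" and L :: "'a \<Rightarrow>\<^sub>L 'a"
  assumes F: "\<And>\<tau>. 0 \<le> \<tau> \<Longrightarrow> \<tau> \<le> 1 \<Longrightarrow>
        (F has_derivative blinfun_apply (F' (a + \<tau> *\<^sub>R e))) (at (a + \<tau> *\<^sub>R e))"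
    and \<beta>: "0 \<le> \<beta>"
    and cont: "continuous_on {0..1} \<phi>"
    and deriv: "\<And>\<tau>. 0 < \<tau> \<Longrightarrow> \<tau> < 1 \<Longrightarrow> (\<phi> has_real_derivative \<phi>' \<tau>) (at \<tau>)"
    and bound: "\<And>\<tau>. 0 < \<tau> \<Longrightarrow> \<tau> < 1 \<Longrightarrow> \<beta> * norm (F' (a + \<tau> *\<^sub>R e) - L) * norm e \<le> \<phi>' \<tau>"
  shows "\<beta> * norm (F (a + e) - F a - L e) \<le> \<phi> 1 - \<phi> 0"
proof -
  define g where "g \<tau> = \<beta> *\<^sub>R (F (a + \<tau> *\<^sub>R e) - \<tau> *\<^sub>R L e)" for \<tau>
  have g': "(g has_vector_derivative \<beta> *\<^sub>R (F' (a + \<tau> *\<^sub>R e) e - L e)) (at \<tau>)"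
    if "0 \<le> \<tau>" "\<tau> \<le> 1" for \<tau>
  proof -
    have line: "((\<lambda>\<tau>. a + \<tau> *\<^sub>R e) has_derivative (\<lambda>h. h *\<^sub>R e)) (at \<tau>)"
      by (auto intro!: derivative_eq_intros)
    have "((\<lambda>\<tau>. F (a + \<tau> *\<^sub>R e)) has_derivative (\<lambda>h. F' (a + \<tau> *\<^sub>R e) (h *\<^sub>R e))) (at \<tau>)"
      using has_derivative_compose[OF line F[OF that]] by simp
    then have "((\<lambda>\<tau>. F (a + \<tau> *\<^sub>R e)) has_vector_derivative F' (a + \<tau> *\<^sub>R e) e) (at \<tau>)"
      by (simp add: has_vector_derivative_def blinfun.scaleR_right)
    then show ?thesis
      unfolding g_def by (auto intro!: derivative_eq_intros)
  qed
  have "norm (g 1 - g 0) \<le> \<phi> 1 - \<phi> 0"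
  proof (rule differentiable_bound_general[OF zero_less_one _ cont])
    show "continuous_on {0..1} g"
      using g' by (intro continuous_at_imp_continuous_on ballI)
        (auto intro: has_vector_derivative_continuous)
    fix \<tau> :: real assume \<tau>: "0 < \<tau>" "\<tau> < 1"
    show "(g has_vector_derivative \<beta> *\<^sub>R (F' (a + \<tau> *\<^sub>R e) e - L e)) (at \<tau>)"
      using \<tau> by (intro g') auto
    show "(\<phi> has_vector_derivative \<phi>' \<tau>) (at \<tau>)"
      using deriv[OF \<tau>] by (simp add: has_real_derivative_iff_has_vector_derivative)
    have "norm (\<beta> *\<^sub>R (F' (a + \<tau> *\<^sub>R e) e - L e)) = \<beta> * norm ((F' (a + \<tau> *\<^sub>R e) - L) e)"
      using \<beta> by (simp add: blinfun.diff_left)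
    also have "\<dots> \<le> \<beta> * (norm (F' (a + \<tau> *\<^sub>R e) - L) * norm e)"
      by (intro mult_left_mono norm_blinfun \<beta>)
    also have "\<dots> \<le> \<phi>' \<tau>" using bound[OF \<tau>] by (simp add: mult.assoc)
    finally show "norm (\<beta> *\<^sub>R (F' (a + \<tau> *\<^sub>R e) e - L e)) \<le> \<phi>' \<tau>" .
  qed
  also have "g 1 - g 0 = \<beta> *\<^sub>R (F (a + e) - F a - L e)"
    by (simp add: g_def algebra_simps)
  finally show ?thesis using \<beta> by simp
qed

lemma zero_in_elt_set_plus_iff: "0 \<in> c +o S \<longleftrightarrow> - c \<in> S" for c :: "'a::ab_group_add"
proof -
  have "0 = c + b \<longleftrightarrow> b = - c" for b 
    unfolding add_eq_0_iff[symmetric] by (rule eq_commute)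
  then show ?thesis by (simp add: elt_set_plus_def)
qed

section \<open>Consequences of the majorant condition\<close>

context
  fixes \<Omega> :: "'a::{real_inner, complete_space} set"
    and F :: "'a \<Rightarrow> 'a" and F' :: "'a \<Rightarrow> 'a \<Rightarrow>\<^sub>L 'a" and T :: "'a \<Rightarrow> 'a set" and xs :: 'a
    and R \<kappa> \<beta> :: real and f f' f'' :: "real \<Rightarrow> real"
  assumes R: "0 < R"
    and majorant: "majorant_function R f f' f''"
    and problem: "majorized_problem \<Omega> F F' T xs R \<kappa> f'"
    and \<beta>: "\<beta> = norm (inverse_op (hat_op (F' xs)))"
begin

lemma
  shows open_Omega: "open \<Omega>" and xs_in_Omega: "xs \<in> \<Omega>"
    and F_deriv: "\<forall>x\<in>\<Omega>. (F has_derivative blinfun_apply (F' x)) (at x)"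
    and maximal_T: "maximal_monotone_op T"
    and xs_solves: "0 \<in> F xs +o T xs"
    and derivative_positive: "positive_op (F' xs)" and derivative_invertible: "invertible_op (hat_op (F' xs))"
    and kappa_eq: "\<kappa> = Sup {t\<in>{0..<R}. ball xs t \<subseteq> \<Omega>}"
    and majorant_condition: "\<forall>\<tau>\<in>{0..1}. \<forall>x\<in>ball xs \<kappa>.
      \<beta> * norm (F' x - F' (xs + \<tau> *\<^sub>R (x - xs))) \<le> f' (norm (x - xs)) - f' (\<tau> * norm (x - xs))"
  by (insert problem, unfold majorized_problem_def \<beta>) (elim conjE, assumption)+

text \<open>A point at distance less than \<open>\<kappa>\<close> already lies in an admissible
  ball, so the inclusion passes to the supremum whether or not it is attained.\<close>

lemma kappa_pos: "0 < \<kappa>" and kappa_le_R: "\<kappa> \<le> R" and ball_kappa_subset: "ball xs \<kappa> \<subseteq> \<Omega>"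
proof -
  let ?S = "{t\<in>{0..<R}. ball xs t \<subseteq> \<Omega>}"
  note \<kappa> = kappa_eq
  obtain e where e: "0 < e" "ball xs e \<subseteq> \<Omega>"
    using openE open_Omega xs_in_Omega by blast
  have bdd: "bdd_above ?S" by (auto intro!: bdd_aboveI[of _ R])
  have "ball xs (min e (R / 2)) \<subseteq> \<Omega>" using e by (auto intro: subset_trans[OF subset_ball])
  then have eS: "min e (R / 2) \<in> ?S" using e R by auto
  then have "min e (R / 2) \<le> \<kappa>" unfolding \<kappa> using bdd by (rule cSup_upper)
  then show "0 < \<kappa>" using e R by (auto simp: min_def split: if_splits)
  have ne: "?S \<noteq> {}" using eS by blast
  then show "\<kappa> \<le> R" unfolding \<kappa> by (rule cSup_least) simp
  show "ball xs \<kappa> \<subseteq> \<Omega>"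
  proof
    fix x assume "x \<in> ball xs \<kappa>"
    then obtain s where "s \<in> ?S" "dist xs x < s"
      using less_SupE[OF _ ne] unfolding \<kappa> by auto
    then show "x \<in> \<Omega>" by auto
  qed
qed

lemma beta_nonneg: "0 \<le> \<beta>"
  by (simp add: \<beta>)

lemma derivative_majorized:
  assumes "x \<in> ball xs \<kappa>" "0 \<le> \<tau>" "\<tau> \<le> 1"
  shows "\<beta> * norm (F' x - F' (xs + \<tau> *\<^sub>R (x - xs))) \<le> f' (norm (x - xs)) - f' (\<tau> * norm (x - xs))"
  using majorant_condition assms by simp

lemma derivative_majorized_0:
  assumes "x \<in> ball xs \<kappa>"
  shows "\<beta> * norm (F' x - F' xs) \<le> f' (norm (x - xs)) + 1"
  using derivative_majorized[OF assms, of 0] f'_0[OF R majorant] by simp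

lemma solution_xs: "- F xs \<in> T xs"
  using xs_solves by (simp add: zero_in_elt_set_plus_iff)

text \<open>Kept in multiplied form, since \<open>\<beta>\<close> is 0 on the trivial space.\<close>

lemma derivative_coercive_xs: "(norm z)\<^sup>2 \<le> \<beta> * (F' xs z \<bullet> z)"
proof -
  note hat = hat_op_positive[OF derivative_positive]
  obtain B where B: "is_inverse_op (F' xs) B"
    using derivative_invertible unfolding invertible_op_def hat by blast
  show ?thesis
    using positive_op_coercive[OF derivative_positive B] unfolding \<beta> hat inverse_op_eq[OF B] .
qed

text \<open>Perturbation of the coercivity at \<open>xs\<close>: the derivative changes by at most
  \<open>f' + 1\<close> after multiplication by \<open>\<beta>\<close>, and 1 - (f' + 1) =
  -f'.\<close>

lemma derivative_coercive:
  assumes "x \<in> ball xs \<kappa>"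
  shows "- f' (norm (x - xs)) * (norm z)\<^sup>2 \<le> \<beta> * (F' x z \<bullet> z)"
proof -
  have "- (F' x - F' xs) z \<bullet> z \<le> norm ((F' x - F' xs) z) * norm z"
    using norm_cauchy_schwarz[of "- (F' x - F' xs) z" z] by simp
  also have "\<dots> \<le> norm (F' x - F' xs) * norm z * norm z"
    by (intro mult_right_mono norm_blinfun) auto
  finally have "- (F' x - F' xs) z \<bullet> z \<le> norm (F' x - F' xs) * norm z * norm z" .
  then have "\<beta> * (- (F' x - F' xs) z \<bullet> z) \<le> \<beta> * (norm (F' x - F' xs) * norm z * norm z)"
    by (intro mult_left_mono beta_nonneg)
  also have "\<dots> = (\<beta> * norm (F' x - F' xs)) * (norm z)\<^sup>2"
    by (simp add: power2_eq_square)
  also have "\<dots> \<le> (f' (norm (x - xs)) + 1) * (norm z)\<^sup>2"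
    by (intro mult_right_mono derivative_majorized_0 assms) auto
  finally show ?thesis
    using derivative_coercive_xs[of z]
    by (simp add: blinfun.diff_left inner_simps algebra_simps)
qed

lemma segment_in_ball:
  assumes "x \<in> ball xs \<kappa>" "0 \<le> \<tau>" "\<tau> \<le> 1"
  shows "xs + \<tau> *\<^sub>R (x - xs) \<in> ball xs \<kappa>"
proof -
  have "\<tau> * norm (x - xs) \<le> 1 * norm (x - xs)"
    using assms(3) by (intro mult_right_mono) auto
  moreover have "dist xs x = norm (x - xs)"
    by (metis dist_commute dist_norm)
  moreover have "dist xs (xs + \<tau> *\<^sub>R (x - xs)) = \<tau> * norm (x - xs)"
    using assms(2) by (simp add: dist_norm)
  ultimately show ?thesis using assms(1) by simp
qed

lemma F_has_derivative:
  assumes "x \<in> ball xs \<kappa>"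
  shows "(F has_derivative blinfun_apply (F' x)) (at x)"
  using F_deriv subsetD[OF ball_kappa_subset assms] by simp

lemma scaled_norm_bounds:
  assumes "x \<in> ball xs \<kappa>" "0 < \<tau>" "\<tau> < 1" "x \<noteq> xs"
  shows "0 < \<tau> * norm (x - xs)" "\<tau> * norm (x - xs) < R"
proof -
  show "0 < \<tau> * norm (x - xs)" using assms(2,4) by simp
  have "\<tau> * norm (x - xs) < 1 * norm (x - xs)"
    using assms(3,4) by (intro mult_strict_right_mono) auto
  then show "\<tau> * norm (x - xs) < R"
    using assms(1) kappa_le_R by (simp add: dist_norm norm_minus_commute)
qed

lemma continuous_on_f_segment:
  assumes "x \<in> ball xs \<kappa>"
  shows "continuous_on {0..1} (\<lambda>\<tau>. f (\<tau> * norm (x - xs)))"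
proof (rule continuous_on_compose2[OF continuous_on_f(1)[OF R majorant order_refl]])
  show "(\<lambda>\<tau>. \<tau> * norm (x - xs)) ` {0..1} \<subseteq> {0..<R}"
  proof clarsimp
    fix \<tau> :: real assume "0 \<le> \<tau>" "\<tau> \<le> 1"
    then have "\<tau> * norm (x - xs) \<le> 1 * norm (x - xs)"
      by (intro mult_right_mono) auto
    then show "\<tau> * norm (x - xs) < R"
      using assms kappa_le_R by (simp add: dist_norm norm_minus_commute)
  qed
qed (auto intro!: continuous_intros)

section \<open>Linearization errors\<close>

text \<open>Integrating \<open>(f' s - f' (\<tau> * s)) * s\<close> over [0,1] gives the numerator
  of the Newton map. The case \<open>x = xs\<close> is split off because \<open>f\<close> has only a
  one-sided derivative at 0.\<close>

lemma linearization_error_at_x: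
  assumes x: "x \<in> ball xs \<kappa>"
  shows "\<beta> * norm (F x - F xs - F' x (x - xs))
    \<le> norm (x - xs) * f' (norm (x - xs)) - f (norm (x - xs))"
proof (cases "x = xs")
  case True then show ?thesis using f_0[OF R majorant] by simp
next
  case False
  define s where "s = norm (x - xs)"
  have "\<beta> * norm (F (xs + (x - xs)) - F xs - F' x (x - xs))
      \<le> (1 * s * f' s - f (1 * s)) - (0 * s * f' s - f (0 * s))"
  proof (rule segment_error_bound[where \<phi>' = "\<lambda>\<tau>. (f' s - f' (\<tau> * s)) * s"])
    fix \<tau> :: real assume \<tau>: "0 < \<tau>" "\<tau> < 1"
    show "((\<lambda>\<tau>. \<tau> * s * f' s - f (\<tau> * s)) has_real_derivative (f' s - f' (\<tau> * s)) * s) (at \<tau>)"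
    proof -
      have "((\<lambda>\<tau>. f (\<tau> * s)) has_real_derivative f' (\<tau> * s) * s) (at \<tau>)"
        using scaled_norm_bounds[OF x \<tau> False]
        by (intro DERIV_chain2[OF DERIV_f(1)[OF R majorant]])
          (auto simp: s_def intro!: derivative_eq_intros)
      then show ?thesis by (auto intro!: derivative_eq_intros simp: algebra_simps)
    qed
    show "\<beta> * norm (F' (xs + \<tau> *\<^sub>R (x - xs)) - F' x) * norm (x - xs) \<le> (f' s - f' (\<tau> * s)) * s"
      using derivative_majorized[OF x, of \<tau>] \<tau>
      by (auto simp: s_def norm_minus_commute intro!: mult_right_mono)
  qed (use x in \<open>auto intro!: F_has_derivative segment_in_ball beta_nonneg continuous_intros
        continuous_on_f_segment simp: s_def simp del: mem_ball\<close>)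
  then show ?thesis using f_0[OF R majorant] by (simp add: s_def)
qed

text \<open>The same integration with the derivative frozen at the solution; the integrand is
  \<open>(f' (\<tau> * s) + 1) * s\<close>.\<close>

lemma linearization_error_at_xs:
  assumes x: "x \<in> ball xs \<kappa>"
  shows "\<beta> * norm (F x - F xs - F' xs (x - xs)) \<le> f (norm (x - xs)) + norm (x - xs)"
proof (cases "x = xs")
  case True then show ?thesis using f_0[OF R majorant] by simp
next
  case False
  define s where "s = norm (x - xs)"
  have "\<beta> * norm (F (xs + (x - xs)) - F xs - F' xs (x - xs))
      \<le> (f (1 * s) + 1 * s) - (f (0 * s) + 0 * s)"
  proof (rule segment_error_bound[where \<phi>' = "\<lambda>\<tau>. (f' (\<tau> * s) + 1) * s"])
    fix \<tau> :: real assume \<tau>: "0 < \<tau>" "\<tau> < 1"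
    show "((\<lambda>\<tau>. f (\<tau> * s) + \<tau> * s) has_real_derivative (f' (\<tau> * s) + 1) * s) (at \<tau>)"
    proof -
      have "((\<lambda>\<tau>. f (\<tau> * s)) has_real_derivative f' (\<tau> * s) * s) (at \<tau>)"
        using scaled_norm_bounds[OF x \<tau> False]
        by (intro DERIV_chain2[OF DERIV_f(1)[OF R majorant]])
          (auto simp: s_def intro!: derivative_eq_intros)
      then show ?thesis by (auto intro!: derivative_eq_intros simp: algebra_simps)
    qed
    show "\<beta> * norm (F' (xs + \<tau> *\<^sub>R (x - xs)) - F' xs) * norm (x - xs) \<le> (f' (\<tau> * s) + 1) * s"
      using derivative_majorized_0[OF segment_in_ball[OF x], of \<tau>] \<tau>
      by (auto simp: s_def intro!: mult_right_mono)
  qed (use x in \<open>auto intro!: F_has_derivative segment_in_ball beta_nonneg continuous_intros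
        continuous_on_f_segment simp: s_def simp del: mem_ball\<close>)
  then show ?thesis using f_0[OF R majorant] by (simp add: s_def)
qed

section \<open>Existence and error of a Newton step, and other solutions\<close>

text \<open>Brings the inclusion to the form of \<open>strongly_monotone_inclusion\<close>, with
  \<open>A = F' x\<close> and \<open>b = F x - F' x x\<close>.\<close>

lemma newton_step_iff: "newton_step F F' T x y \<longleftrightarrow> - (F' x y + (F x - F' x x)) \<in> T y"
proof -
  have "F x + F' x (y - x) = F' x y + (F x - F' x x)" by (simp add: blinfun.diff_right)
  then show ?thesis
    unfolding newton_step_def zero_in_elt_set_plus_iff by (simp only:)
qed

lemma newton_step_ex1:
  assumes x: "x \<in> ball xs \<kappa>" and neg: "f' (norm (x - xs)) < 0"
  shows "\<exists>!y. newton_step F F' T x y"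
proof -
  obtain m where "0 < m" "\<And>z. m * (norm z)\<^sup>2 \<le> F' x z \<bullet> z"
  proof (cases "\<beta> = 0")
    \<comment> \<open>The space is trivial, and any positive constant serves.\<close>
    case True
    then have zero: "z = 0" for z :: 'a using derivative_coercive_xs[of z] by simp
    have "1 * (norm z)\<^sup>2 \<le> F' x z \<bullet> z" for z :: 'a
      unfolding zero[of z] by simp
    then show ?thesis using that[of 1] by simp
  next
    case False
    then have "0 < \<beta>" using beta_nonneg by simp
    then have "- f' (norm (x - xs)) / \<beta> * (norm z)\<^sup>2 \<le> F' x z \<bullet> z" for z
      using derivative_coercive[OF x, of z] by (simp add: field_simps)
    then show ?thesis using that[of "- f' (norm (x - xs)) / \<beta>"] neg \<open>0 < \<beta>\<close> by (simp add: divide_neg_pos)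
  qed
  then show ?thesis
    unfolding newton_step_iff by (intro strongly_monotone_inclusion[OF maximal_T])
qed

text \<open>Monotonicity of \<open>T\<close> between \<open>y\<close> and \<open>xs\<close> bounds
  <F'(x)(y - xs), y - xs> by the linearization error at \<open>x\<close> times |y - xs|; coercivity
  bounds it from below, and one factor |y - xs| cancels.\<close>

lemma newton_step_bound:
  assumes x: "x \<in> ball xs \<kappa>" and neg: "f' (norm (x - xs)) < 0"
    and step: "newton_step F F' T x y"
  shows "norm (y - xs) \<le> f (norm (x - xs)) / f' (norm (x - xs)) - norm (x - xs)"
proof -
  define s where "s = norm (x - xs)"
  define E where "E = F x - F xs - F' x (x - xs)"
  have "0 \<le> (- (F' x y + (F x - F' x x)) - (- F xs)) \<bullet> (y - xs)"
    using monotoneD[OF maximal_T _ solution_xs] step unfolding newton_step_iff by blast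
  also have "- (F' x y + (F x - F' x x)) - (- F xs) = - E - F' x (y - xs)"
    by (simp add: E_def blinfun.diff_right)
  finally have "F' x (y - xs) \<bullet> (y - xs) \<le> - E \<bullet> (y - xs)"
    by (simp add: inner_diff_left)
  also have "\<dots> \<le> norm E * norm (y - xs)"
    using norm_cauchy_schwarz[of "- E" "y - xs"] by simp
  finally have "\<beta> * (F' x (y - xs) \<bullet> (y - xs)) \<le> \<beta> * (norm E * norm (y - xs))"
    by (intro mult_left_mono beta_nonneg)
  then have "- f' s * (norm (y - xs))\<^sup>2 \<le> (\<beta> * norm E) * norm (y - xs)"
    using derivative_coercive[OF x, of "y - xs"] by (simp add: s_def)
  also have "\<dots> \<le> (s * f' s - f s) * norm (y - xs)"
    using linearization_error_at_x[OF x] by (intro mult_right_mono) (auto simp: s_def E_def)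
  finally have *: "(- f' s * norm (y - xs)) * norm (y - xs) \<le> (s * f' s - f s) * norm (y - xs)"
    by (simp add: power2_eq_square)
  have "0 \<le> s * f' s - f s"
    using order_trans[OF mult_nonneg_nonneg[OF beta_nonneg norm_ge_zero] linearization_error_at_x[OF x]]
    by (simp add: s_def)
  \<comment> \<open>Cancellation applies for \<open>y \<noteq> xs\<close>; otherwise the left side
    is 0 and the excess is nonnegative.\<close>
  then have "- f' s * norm (y - xs) \<le> s * f' s - f s"
    using mult_right_le_imp_le[OF *] by (cases "y = xs") auto
  then show ?thesis
    using neg unfolding s_def[symmetric] by (simp add: field_simps)
qed

text \<open>The argument of the step estimate with the linearization at \<open>xs\<close>: it yields
  s^2 <= (f(s) + s) s.\<close>

lemma solution_f_nonneg:
  assumes y: "y \<in> ball xs \<kappa>" "y \<noteq> xs" and sol: "0 \<in> F y +o T y"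
  shows "0 \<le> f (norm (y - xs))"
proof -
  define s where "s = norm (y - xs)"
  define E where "E = F y - F xs - F' xs (y - xs)"
  have "- F y \<in> T y" using sol by (simp add: zero_in_elt_set_plus_iff)
  from monotoneD[OF maximal_T this solution_xs]
  have "0 \<le> (- F y - (- F xs)) \<bullet> (y - xs)" .
  also have "- F y - (- F xs) = - E - F' xs (y - xs)"
    by (simp add: E_def)
  finally have "F' xs (y - xs) \<bullet> (y - xs) \<le> - E \<bullet> (y - xs)"
    by (simp add: inner_diff_left)
  also have "\<dots> \<le> norm E * s"
    using norm_cauchy_schwarz[of "- E" "y - xs"] by (simp add: s_def)
  finally have "\<beta> * (F' xs (y - xs) \<bullet> (y - xs)) \<le> \<beta> * (norm E * s)"
    by (intro mult_left_mono beta_nonneg)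
  then have "s\<^sup>2 \<le> (\<beta> * norm E) * s"
    using derivative_coercive_xs[of "y - xs"] by (simp add: s_def)
  also have "\<dots> \<le> (f s + s) * s"
    using linearization_error_at_xs[OF y(1)] by (intro mult_right_mono) (auto simp: s_def E_def)
  finally have "s * s \<le> (f s + s) * s" by (simp add: power2_eq_square)
  moreover have "0 < s" using y by (simp add: s_def)
  ultimately show ?thesis by (simp add: s_def)
qed

end

section \<open>Optimality of the radius\<close>

lemma maximal_monotone_zero: "maximal_monotone_op (\<lambda>_::real. {0::real})"
  unfolding maximal_monotone_op_def monotone_op_def set_dom_def
proof (intro conjI allI impI)
  fix x u :: real
  assume h: "\<forall>y\<in>{x. {0::real} \<noteq> {}}. \<forall>v\<in>{0}. 0 \<le> (u - v) \<bullet> (x - y)"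
  \<comment> \<open>The test point \<open>x + u\<close> turns the pairing into -u^2.\<close>
  have "0 \<le> (u - 0) \<bullet> (x - (x + u))" using h by blast
  then have "u * u \<le> 0" by simp
  then show "u \<in> {0}" by (auto simp: mult_le_0_iff)
qed simp

text \<open>If \<open>f \<rho> = 2 * \<rho> * f' \<rho>\<close>, Newton's method for this function swaps
  \<open>\<rho>\<close> and \<open>-\<rho>\<close>.\<close>

definition odd_majorant :: "(real \<Rightarrow> real) \<Rightarrow> real \<Rightarrow> real" where
  "odd_majorant f x = (if 0 \<le> x then - f x else f (- x))"

context
  fixes R \<kappa> :: real and f f' f'' :: "real \<Rightarrow> real"
  assumes R: "0 < R"
    and majorant: "majorant_function R f f' f''"
    and \<kappa>: "0 < \<kappa>" "\<kappa> \<le> R"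
begin

text \<open>At 0 only the one-sided derivative of \<open>f\<close> is available; the quotient of the
  odd extension at \<open>h\<close> is \<open>- (f \<bar>h\<bar> / \<bar>h\<bar>)\<close>, so one
  limit serves both sides.\<close>

lemma odd_majorant_DERIV:
  assumes "\<bar>x\<bar> < R"
  shows "(odd_majorant f has_real_derivative - f' \<bar>x\<bar>) (at x)"
proof -
  consider "0 < x" | "x < 0" | "x = 0" by linarith
  then show ?thesis
  proof cases
    case 1
    have "((\<lambda>u. - f u) has_real_derivative - f' x) (at x)"
      using 1 assms by (intro DERIV_minus DERIV_f(1)[OF R majorant]) auto
    then have "(odd_majorant f has_real_derivative - f' x) (at x)"
      using 1 by (elim has_field_derivative_transform_within_open[where S = "{0<..}"])
        (auto simp: odd_majorant_def)
    then show ?thesis using 1 by simp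
  next
    case 2
    have "((\<lambda>u. f (- u)) has_real_derivative f' (- x) * - 1) (at x)"
      using 2 assms
      by (intro DERIV_chain2[OF DERIV_f(1)[OF R majorant]]) (auto intro!: derivative_eq_intros)
    then have "(odd_majorant f has_real_derivative f' (- x) * - 1) (at x)"
      using 2 by (elim has_field_derivative_transform_within_open[where S = "{..<0}"])
        (auto simp: odd_majorant_def)
    then show ?thesis using 2 by simp
  next
    case 3
    have lim: "((\<lambda>t. f t / t) \<longlongrightarrow> -1) (at 0 within {0..<R})"
      using f_within[OF R majorant, of 0] R f_0[OF R majorant] f'_0[OF R majorant]
      by (simp add: has_field_derivative_iff)
    have "((\<lambda>h. odd_majorant f h / h) \<longlongrightarrow> 1) (at 0)"
      unfolding tendsto_iff
    proof (intro allI impI)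
      fix e :: real assume "0 < e"
      then have "\<forall>\<^sub>F t in at 0 within {0..<R}. dist (f t / t) (-1) < e"
        using lim by (simp add: tendsto_iff)
      then obtain d where d: "0 < d"
          "\<And>t. t \<in> {0..<R} \<Longrightarrow> t \<noteq> 0 \<Longrightarrow> dist t 0 < d \<Longrightarrow> dist (f t / t) (-1) < e"
        unfolding eventually_at by blast
      have "dist (odd_majorant f h / h) 1 < e" if "h \<noteq> 0" "dist h 0 < min d R" for h
      proof -
        have "odd_majorant f h / h = - (f \<bar>h\<bar> / \<bar>h\<bar>)"
          using that by (auto simp: odd_majorant_def)
        then have "dist (odd_majorant f h / h) 1 = dist (f \<bar>h\<bar> / \<bar>h\<bar>) (-1)"
          unfolding dist_real_def by linarith
        then show ?thesis using d(2)[of "\<bar>h\<bar>"] that by simp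
      qed
      then show "\<forall>\<^sub>F h in at 0. dist (odd_majorant f h / h) 1 < e"
        unfolding eventually_at using d(1) R by (intro exI[of _ "min d R"]) auto
    qed
    moreover have "odd_majorant f 0 = 0"
      by (simp add: odd_majorant_def f_0[OF R majorant])
    ultimately have "(odd_majorant f has_real_derivative 1) (at 0)"
      by (simp add: has_field_derivative_iff)
    then show ?thesis using 3 by (simp add: f'_0[OF R majorant])
  qed
qed

text \<open>Ensures that the example on \<open>ball 0 \<kappa>\<close> has the prescribed
  \<open>\<kappa>\<close>. Density handles \<open>\<kappa> = R\<close>, where the supremum is not
  attained.\<close>

lemma Sup_balls_real: "\<kappa> = Sup {t\<in>{0..<R}. ball (0::real) t \<subseteq> ball 0 \<kappa>}" (is "_ = Sup ?S")
proof (rule antisym)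
  have bdd: "bdd_above ?S" by (rule bdd_aboveI[of _ R]) simp
  show "\<kappa> \<le> Sup ?S"
  proof (rule dense_le_bounded[OF \<kappa>(1)])
    fix t assume t: "0 < t" "t < \<kappa>"
    then have "t \<in> ?S" using \<kappa> subset_ball[of t \<kappa> 0] by simp
    then show "t \<le> Sup ?S" using bdd by (rule cSup_upper)
  qed
  have "0 \<in> ?S" using R by simp
  then have "?S \<noteq> {}" by blast
  then show "Sup ?S \<le> \<kappa>"
  proof (rule cSup_least)
    fix t assume t: "t \<in> ?S"
    show "t \<le> \<kappa>"
    proof (rule ccontr)
      assume "\<not> t \<le> \<kappa>"
      then have "\<kappa> \<in> ball 0 t" using \<kappa> by simp
      then have "\<kappa> \<in> ball 0 \<kappa>" using t by blast
      then show False using \<kappa> by simp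
    qed
  qed
qed

text \<open>The derivative at 0 is the identity, whose inverse has norm 1, and the majorant
  condition holds with equality.\<close>

lemma odd_majorant_problem:
  "majorized_problem (ball 0 \<kappa>) (odd_majorant f) (\<lambda>x. (- f' \<bar>x\<bar>) *\<^sub>R id_blinfun)
     (\<lambda>_. {0}) 0 R \<kappa> f'"
proof -
  let ?G = "\<lambda>x::real. (- f' \<bar>x\<bar>) *\<^sub>R (id_blinfun :: real \<Rightarrow>\<^sub>L real)"
  have abs_less: "\<bar>x\<bar> < R" if "x \<in> ball 0 \<kappa>" for x :: real
    using that \<kappa> by simp
  have G0: "?G 0 = id_blinfun"
    by (simp add: f'_0[OF R majorant])
  have pos: "positive_op (id_blinfun :: real \<Rightarrow>\<^sub>L real)"
    by (simp add: positive_op_def)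
  have inv: "is_inverse_op (id_blinfun :: real \<Rightarrow>\<^sub>L real) id_blinfun"
    unfolding is_inverse_op_def by (auto intro!: blinfun_eqI)
  have deriv: "(odd_majorant f has_derivative blinfun_apply (?G x)) (at x)" if "x \<in> ball 0 \<kappa>" for x
  proof -
    have "blinfun_apply (?G x) = (*) (- f' \<bar>x\<bar>)"
      by (auto simp: blinfun.scaleR_left blinfun.minus_left)
    then show ?thesis
      using odd_majorant_DERIV[OF abs_less[OF that]] by (simp only: has_field_derivative_def)
  qed
  have cont: "continuous_on (ball 0 \<kappa>) (odd_majorant f)"
    using deriv by (intro continuous_at_imp_continuous_on ballI has_derivative_continuous)
  have "continuous_on (ball 0 \<kappa>) (\<lambda>x::real. f' \<bar>x\<bar>)"
    by (rule continuous_on_compose2[OF continuous_on_f(2)[OF R majorant order_refl]])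
      (use \<kappa> in \<open>auto intro!: continuous_intros\<close>)
  then have contG: "continuous_on (ball 0 \<kappa>) ?G"
    by (intro continuous_intros)
  have major: "norm (id_blinfun :: real \<Rightarrow>\<^sub>L real) * norm (?G x - ?G (0 + \<tau> *\<^sub>R (x - 0)))
      \<le> f' (norm (x - 0)) - f' (\<tau> * norm (x - 0))"
    if \<tau>: "\<tau> \<in> {0..1}" and x: "x \<in> ball 0 \<kappa>" for \<tau> x
  proof -
    have "\<tau> * \<bar>x\<bar> \<le> 1 * \<bar>x\<bar>" using \<tau> by (intro mult_right_mono) auto
    then have le: "f' (\<tau> * \<bar>x\<bar>) \<le> f' \<bar>x\<bar>"
      using \<tau> abs_less[OF x] by (intro f'_le[OF R majorant]) auto
    have "?G x - ?G (0 + \<tau> *\<^sub>R (x - 0)) = (f' (\<tau> * \<bar>x\<bar>) - f' \<bar>x\<bar>) *\<^sub>R id_blinfun"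
      using \<tau> by (simp add: abs_mult algebra_simps)
    then have "norm (?G x - ?G (0 + \<tau> *\<^sub>R (x - 0))) = f' \<bar>x\<bar> - f' (\<tau> * \<bar>x\<bar>)"
      using le by (simp only: norm_scaleR norm_blinfun_id) simp
    then show ?thesis by (simp only: norm_blinfun_id) simp
  qed
  show ?thesis
    unfolding majorized_problem_def G0 hat_op_positive[OF pos] inverse_op_eq[OF inv]
    using \<kappa>(1) cont deriv contG maximal_monotone_zero pos inv Sup_balls_real major
    by (intro conjI ballI)
      (simp_all add: invertible_op_def elt_set_plus_def odd_majorant_def f_0[OF R majorant]
        exI[of _ id_blinfun])
qed

text \<open>The cycle condition says \<open>f \<rho> = 2 * (\<rho> * f' \<rho>)\<close>, which
  reduces the linearized equation at both points to
  \<open>- f' \<rho> * (x + y) = 0\<close>.\<close>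

lemma odd_majorant_newton_cycle:
  assumes \<rho>: "0 < \<rho>" "\<rho> < \<kappa>" and neg: "f' \<rho> < 0" and cycle: "f \<rho> / (\<rho> * f' \<rho>) - 1 = 1"
  shows "newton_sequence (ball 0 \<kappa>) (odd_majorant f) (\<lambda>x. (- f' \<bar>x\<bar>) *\<^sub>R id_blinfun)
     (\<lambda>_. {0}) \<rho> (\<lambda>k. (-1) ^ k * \<rho>)"
proof -
  have f\<rho>: "f \<rho> = 2 * (\<rho> * f' \<rho>)"
    using \<rho> neg cycle by (simp add: divide_eq_eq)
  have step: "newton_step (odd_majorant f) (\<lambda>x. (- f' \<bar>x\<bar>) *\<^sub>R id_blinfun) (\<lambda>_. {0}) x y
      \<longleftrightarrow> y = - x" if "x = \<rho> \<or> x = - \<rho>" for x y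
  proof -
    have "odd_majorant f x = - 2 * (x * f' \<rho>)"
      using that \<rho> f\<rho> by (auto simp: odd_majorant_def)
    moreover have "\<bar>x\<bar> = \<rho>" using that \<rho> by auto
    ultimately have "newton_step (odd_majorant f) (\<lambda>x. (- f' \<bar>x\<bar>) *\<^sub>R id_blinfun) (\<lambda>_. {0}) x y
      \<longleftrightarrow> - f' \<rho> * (x + y) = 0"
      by (auto simp: newton_step_def elt_set_plus_def blinfun.scaleR_left blinfun.minus_left
          algebra_simps)
    also have "\<dots> \<longleftrightarrow> y = - x" using neg by (auto simp: add_eq_0_iff)
    finally show ?thesis .
  qed
  have alt: "(-1) ^ k * \<rho> = \<rho> \<or> (-1) ^ k * \<rho> = - \<rho>" for k :: nat
    by (cases "even k") auto
  show ?thesis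
    unfolding newton_sequence_def step[OF alt]
  proof (intro conjI allI)
    fix k :: nat
    show "(-1) ^ k * \<rho> \<in> ball 0 \<kappa>" using \<rho> alt[of k] by auto
  qed auto
qed

end

lemma alternating_not_tendsto_0:
  fixes \<rho> :: real
  assumes "0 < \<rho>"
  shows "\<not> (\<lambda>k. (-1) ^ k * \<rho>) \<longlonglongrightarrow> 0"
proof
  assume "(\<lambda>k. (-1) ^ k * \<rho>) \<longlonglongrightarrow> 0"
  then have "(\<lambda>k. \<bar>(-1) ^ k * \<rho>\<bar>) \<longlonglongrightarrow> 0" by (rule tendsto_rabs_zero)
  then have "(\<lambda>k::nat. \<rho>) \<longlonglongrightarrow> 0" using assms by (simp add: abs_mult power_abs)
  then show False using assms by (simp add: LIMSEQ_const_iff)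
qed

section \<open>Local convergence\<close>

theorem theorem4:
  fixes \<Omega> :: "'a::{real_inner, complete_space} set"
    and F :: "'a \<Rightarrow> 'a" and F' :: "'a \<Rightarrow> 'a \<Rightarrow>\<^sub>L 'a" and T :: "'a \<Rightarrow> 'a set" and xs :: 'a
    and f f' f'' :: "real \<Rightarrow> real"
    and R \<kappa> \<nu> \<rho> r \<sigma> \<sigma>bar :: real
  assumes R: "0 < R"
    and majorant: "majorant_function R f f' f''"
    and problem: "majorized_problem \<Omega> F F' T xs R \<kappa> f'"
    and \<nu>: "\<nu> = Sup {t\<in>{0..<R}. f' t < 0}"
    and \<rho>: "\<rho> = Sup {t\<in>{0<..<\<nu>}. f t / (t * f' t) - 1 < 1}"
    and r: "r = min \<kappa> \<rho>"
    and \<sigma>: "\<sigma> = Sup {t\<in>{0<..<\<kappa>}. f t < 0}"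
    and \<sigma>bar: "\<sigma>bar = min r \<sigma>"
  shows "(\<forall>x0 \<in> ball xs r - {xs}. \<exists>x t.
            newton_sequence \<Omega> F F' T x0 x \<and>
            majorant_sequence R f f' (norm (xs - x0)) t \<and>
            strict_antimono_on UNIV t \<and> range t \<subseteq> {0<..<r} \<and> t \<longlonglongrightarrow> 0 \<and>
            range x \<subseteq> ball xs r \<and> x \<longlonglongrightarrow> xs \<and>
            {y \<in> ball xs \<sigma>bar. 0 \<in> F y +o T y} = {xs} \<and>
            strict_antimono_on UNIV (\<lambda>k. t (Suc k) / (t k)\<^sup>2) \<and>
            (\<forall>k. norm (xs - x (Suc k)) \<le> (t (Suc k) / (t k)\<^sup>2) * (norm (x k - xs))\<^sup>2 \<and>
                 t (Suc k) / (t k)\<^sup>2 \<le> f'' (t 0) / (2 * \<bar>f' (t 0)\<bar>)))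
       \<and> (f \<rho> / (\<rho> * f' \<rho>) - 1 = 1 \<and> \<rho> < \<kappa> \<longrightarrow>
            r = \<rho> \<and>
            (\<exists>(\<Omega>1 :: real set) F1 F1' T1 xs1 x1.
               majorized_problem \<Omega>1 F1 F1' T1 xs1 R \<kappa> f' \<and>
               newton_sequence \<Omega>1 F1 F1' T1 (x1 0) x1 \<and>
               dist (x1 0) xs1 = \<rho> \<and> \<not> x1 \<longlonglongrightarrow> xs1))"
proof (rule conjI)
  have kr: "0 < \<kappa>" "\<kappa> \<le> R" "ball xs \<kappa> \<subseteq> \<Omega>"
    using kappa_pos[OF R majorant problem refl] kappa_le_R[OF R majorant problem refl]
      ball_kappa_subset[OF R majorant problem refl] by auto
  have \<rho>_pos: "0 < \<rho>"
    by (rule rho_pos[OF R majorant \<nu> \<rho>])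
  have r_le: "0 < r" "r \<le> \<rho>" "r \<le> \<kappa>" using kr \<rho>_pos by (auto simp: r)
  have sol_set: "{y \<in> ball xs \<sigma>bar. 0 \<in> F y +o T y} = {xs}"
  proof -
    let ?S = "{t\<in>{0<..<\<kappa>}. f t < 0}"
    obtain s where s: "s \<in> ?S"
    proof -
      obtain d where d: "0 < d" "d < R" "\<And>t. 0 \<le> t \<Longrightarrow> t \<le> d \<Longrightarrow> f' t < 0"
        using f'_small_near_0[OF R majorant, of 0] by auto
      define s where "s = min d \<kappa> / 2"
      have s: "0 < s" "s < \<kappa>" "s \<le> d" "s < R" using d kr by (auto simp: s_def)
      have "f s < s * f' s" using majorant_excess_pos[OF R majorant s(1,4)] by simp
      also have "\<dots> < 0" using s d(3)[of s] by (simp add: mult_pos_neg)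
      finally show ?thesis using that[of s] s by simp
    qed
    have bdd: "bdd_above ?S" by (rule bdd_aboveI[of _ \<kappa>]) simp
    have "0 < \<sigma>" using cSup_upper[OF s bdd] s unfolding \<sigma> by simp
    then have "xs \<in> ball xs \<sigma>bar" using r_le by (simp add: \<sigma>bar)
    moreover have "y = xs" if y: "y \<in> ball xs \<sigma>bar" "0 \<in> F y +o T y" for y
    proof (rule ccontr)
      assume "y \<noteq> xs"
      define u where "u = norm (y - xs)"
      have u: "0 < u" "u < \<sigma>" "u < \<kappa>"
        using y \<open>y \<noteq> xs\<close> r_le by (auto simp: u_def \<sigma>bar dist_norm norm_minus_commute)
      then obtain v where v: "v \<in> ?S" "u < v"
        using less_SupE[of u ?S] s unfolding \<sigma> by blast
      \<comment> \<open>A point \<open>v\<close> beyond \<open>u\<close> with \<open>f v < 0\<close>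
        forces \<open>f u < 0\<close>, against the sign of \<open>f\<close> at the distance of a
        second solution.\<close>
      have "f u / u \<le> f v / v"
        using majorant_slope_mono[OF R majorant, of u v] u v kr by simp
      also have "\<dots> < 0" using u v by (simp add: divide_neg_pos)
      finally have "f u < 0" using u by (simp add: divide_less_0_iff)
      moreover have "y \<in> ball xs \<kappa>"
        using u by (simp add: u_def dist_norm norm_minus_commute)
      ultimately show False
        using solution_f_nonneg[OF R majorant problem refl _ \<open>y \<noteq> xs\<close> y(2)] by (simp add: u_def)
    qed
    moreover have "0 \<in> F xs +o T xs"
      using xs_solves[OF R majorant problem refl] .
    ultimately show ?thesis by blast
  qed
  show "\<forall>x0 \<in> ball xs r - {xs}. \<exists>x t.
            newton_sequence \<Omega> F F' T x0 x \<and>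
            majorant_sequence R f f' (norm (xs - x0)) t \<and>
            strict_antimono_on UNIV t \<and> range t \<subseteq> {0<..<r} \<and> t \<longlonglongrightarrow> 0 \<and>
            range x \<subseteq> ball xs r \<and> x \<longlonglongrightarrow> xs \<and>
            {y \<in> ball xs \<sigma>bar. 0 \<in> F y +o T y} = {xs} \<and>
            strict_antimono_on UNIV (\<lambda>k. t (Suc k) / (t k)\<^sup>2) \<and>
            (\<forall>k. norm (xs - x (Suc k)) \<le> (t (Suc k) / (t k)\<^sup>2) * (norm (x k - xs))\<^sup>2 \<and>
                 t (Suc k) / (t k)\<^sup>2 \<le> f'' (t 0) / (2 * \<bar>f' (t 0)\<bar>))"
  proof
    fix x0 assume x0: "x0 \<in> ball xs r - {xs}"
    define t0 where "t0 = norm (xs - x0)"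
    have t0: "0 < t0" "t0 < r" using x0 by (auto simp: t0_def dist_norm)
    define t where "t = rec_nat t0 (\<lambda>_ u. \<bar>u - f u / f' u\<bar>)"
    \<comment> \<open>The description denotes the Newton step only where that step is unique;
      \<open>step_THE\<close> secures this along with the bound by \<open>t k\<close>.\<close>
    define x where "x = rec_nat x0 (\<lambda>_ u. THE y. newton_step F F' T u y)"
    note seq = R majorant \<nu> \<rho> r_le(2) t0
    have t_bounds: "0 < t k" "t k < r" and t_Suc: "t (Suc k) = f (t k) / f' (t k) - t k"
      and t_nu: "t k < R" "f' (t k) < 0" for k
      using majorant_seq_bounds[OF seq] majorant_seq_Suc[OF seq] majorant_seq_below_nu[OF seq]
      by (simp_all add: t_def)
    have t_lim: "t \<longlonglongrightarrow> 0"
      unfolding t_def by (rule majorant_seq_tendsto_0[OF seq])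
    \<comment> \<open>Stated for any \<open>u\<close> within distance \<open>t k\<close>, so that it
      can drive the induction for \<open>x_le\<close>. The error bound at
      \<open>norm (u - xs)\<close> is carried over to \<open>t k\<close> by monotonicity of
      n(s)/s^2.\<close>
    have step: "\<exists>!y. newton_step F F' T u y"
      and step_bound: "newton_step F F' T u y \<Longrightarrow>
        norm (y - xs) \<le> t (Suc k) / (t k)\<^sup>2 * (norm (u - xs))\<^sup>2"
      if u: "norm (u - xs) \<le> t k" for u y k
    proof -
      define s where "s = norm (u - xs)"
      have s: "0 \<le> s" "s \<le> t k" "s < R" using u t_nu[of k] by (auto simp: s_def)
      have neg: "f' s < 0"
        using f'_le[OF R majorant s(1,2)] t_nu[of k] by simp
      have u\<kappa>: "u \<in> ball xs \<kappa>"
        using u t_bounds[of k] r_le by (simp add: dist_norm norm_minus_commute)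
      show "\<exists>!y. newton_step F F' T u y"
        using newton_step_ex1[OF R majorant problem refl u\<kappa>] neg by (simp add: s_def)
      assume "newton_step F F' T u y"
      then have "norm (y - xs) \<le> f s / f' s - s"
        using newton_step_bound[OF R majorant problem refl u\<kappa>] neg by (simp add: s_def)
      also have "\<dots> \<le> t (Suc k) / (t k)\<^sup>2 * s\<^sup>2"
      proof (cases "s = 0")
        case True
        then show ?thesis by (simp add: f_0[OF R majorant])
      next
        case False
        then have "0 < s" using s by simp
        have "(f s / f' s - s) / s\<^sup>2 \<le> (f (t k) / f' (t k) - t k) / (t k)\<^sup>2"
        proof (cases "s = t k")
          case False
          then show ?thesis
            using newton_map_ratio_less[OF R majorant \<open>0 < s\<close>, of "t k"] s t_nu[of k] by simp
        qed simp
        then have "(f s / f' s - s) / s\<^sup>2 \<le> t (Suc k) / (t k)\<^sup>2"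
          by (simp only: t_Suc)
        then show ?thesis
          using \<open>0 < s\<close> by (simp add: pos_divide_le_eq)
      qed
      finally show "norm (y - xs) \<le> t (Suc k) / (t k)\<^sup>2 * (norm (u - xs))\<^sup>2"
        by (simp add: s_def)
    qed
    have step_THE: "newton_step F F' T (x k) (x (Suc k))" if "norm (x k - xs) \<le> t k" for k
      using theI'[OF step[OF that]] by (simp add: x_def)
    have x_le: "norm (x k - xs) \<le> t k" for k
    proof (induction k)
      case 0
      then show ?case by (simp add: x_def t_def t0_def norm_minus_commute)
    next
      case (Suc k)
      have "norm (x (Suc k) - xs) \<le> t (Suc k) / (t k)\<^sup>2 * (norm (x k - xs))\<^sup>2"
        by (rule step_bound[OF Suc step_THE[OF Suc]])
      also have "\<dots> \<le> t (Suc k) / (t k)\<^sup>2 * (t k)\<^sup>2"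
        using Suc t_bounds[of "Suc k"] by (intro mult_left_mono power_mono) auto
      also have "\<dots> = t (Suc k)" using t_bounds[of k] by simp
      finally show ?case .
    qed
    have x_ball: "x k \<in> ball xs r" for k
      using x_le[of k] t_bounds[of k] by (simp add: dist_norm norm_minus_commute)
    have "newton_sequence \<Omega> F F' T x0 x"
      unfolding newton_sequence_def
    proof (intro conjI allI)
      show "x 0 = x0" by (simp add: x_def)
      fix k
      show "x k \<in> \<Omega>" using x_ball[of k] kr(3) subset_ball[OF r_le(3), of xs] by blast
      show "\<exists>!y. newton_step F F' T (x k) y" by (rule step[OF x_le])
      show "newton_step F F' T (x k) (x (Suc k))" by (rule step_THE[OF x_le])
    qed
    moreover have "(\<lambda>k. x k - xs) \<longlonglongrightarrow> 0"
      by (rule Lim_null_comparison[OF always_eventually t_lim]) (rule allI, rule x_le)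
    then have "x \<longlonglongrightarrow> xs" by (simp only: LIM_zero_iff)
    moreover have "norm (xs - x (Suc k)) \<le> (t (Suc k) / (t k)\<^sup>2) * (norm (x k - xs))\<^sup>2" for k
      using step_bound[OF x_le step_THE[OF x_le], of k] by (simp add: norm_minus_commute)
    moreover have "range t \<subseteq> {0<..<r}" "range x \<subseteq> ball xs r"
      using t_bounds x_ball by auto
    ultimately show "\<exists>x t.
            newton_sequence \<Omega> F F' T x0 x \<and>
            majorant_sequence R f f' (norm (xs - x0)) t \<and>
            strict_antimono_on UNIV t \<and> range t \<subseteq> {0<..<r} \<and> t \<longlonglongrightarrow> 0 \<and>
            range x \<subseteq> ball xs r \<and> x \<longlonglongrightarrow> xs \<and>
            {y \<in> ball xs \<sigma>bar. 0 \<in> F y +o T y} = {xs} \<and>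
            strict_antimono_on UNIV (\<lambda>k. t (Suc k) / (t k)\<^sup>2) \<and>
            (\<forall>k. norm (xs - x (Suc k)) \<le> (t (Suc k) / (t k)\<^sup>2) * (norm (x k - xs))\<^sup>2 \<and>
                 t (Suc k) / (t k)\<^sup>2 \<le> f'' (t 0) / (2 * \<bar>f' (t 0)\<bar>))"
      using sol_set majorant_sequence_seq[OF seq, folded t_def, unfolded t0_def]
        majorant_seq_strict_antimono[OF seq, folded t_def]
        t_lim
        majorant_seq_ratio_strict_antimono[OF seq, folded t_def]
        majorant_seq_ratio_bound[OF seq, folded t_def]
      by (intro exI[of _ x] exI[of _ t] conjI allI)
  qed
  show "f \<rho> / (\<rho> * f' \<rho>) - 1 = 1 \<and> \<rho> < \<kappa> \<longrightarrow>
            r = \<rho> \<and>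
            (\<exists>(\<Omega>1 :: real set) F1 F1' T1 xs1 x1.
               majorized_problem \<Omega>1 F1 F1' T1 xs1 R \<kappa> f' \<and>
               newton_sequence \<Omega>1 F1 F1' T1 (x1 0) x1 \<and>
               dist (x1 0) xs1 = \<rho> \<and> \<not> x1 \<longlonglongrightarrow> xs1)"
  proof (intro impI conjI)
    assume asm: "f \<rho> / (\<rho> * f' \<rho>) - 1 = 1 \<and> \<rho> < \<kappa>"
    then show "r = \<rho>" by (simp add: r)
    \<comment> \<open>Division by zero yields 0, so a vanishing \<open>f' \<rho>\<close> would give
      -1 instead of 1.\<close>
    have "f' \<rho> \<noteq> 0" using asm by auto
    then have "f \<rho> = 2 * (\<rho> * f' \<rho>)"
      using asm \<rho>_pos by (simp add: divide_eq_eq)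
    moreover have "f \<rho> < \<rho> * f' \<rho>"
      using majorant_excess_pos[OF R majorant \<rho>_pos] asm kr by simp
    \<comment> \<open>As \<open>\<rho>\<close> may equal \<open>\<nu>\<close>, the sign is derived
      from 2 a < a with a = \<open>\<rho> * f' \<rho>\<close>.\<close>
    ultimately have "\<rho> * f' \<rho> < 0" by linarith
    then have neg: "f' \<rho> < 0" using \<rho>_pos by (simp add: mult_less_0_iff)
    let ?x = "\<lambda>k::nat. (-1) ^ k * \<rho>"
    have "newton_sequence (ball 0 \<kappa>) (odd_majorant f) (\<lambda>x. (- f' \<bar>x\<bar>) *\<^sub>R id_blinfun) (\<lambda>_. {0})
        (?x 0) ?x"
      using odd_majorant_newton_cycle[OF R majorant kr(1,2) \<rho>_pos _ neg] asm by simp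
    moreover have "dist (?x 0) 0 = \<rho>" using \<rho>_pos by simp
    ultimately show "\<exists>(\<Omega>1 :: real set) F1 F1' T1 xs1 x1.
               majorized_problem \<Omega>1 F1 F1' T1 xs1 R \<kappa> f' \<and>
               newton_sequence \<Omega>1 F1 F1' T1 (x1 0) x1 \<and>
               dist (x1 0) xs1 = \<rho> \<and> \<not> x1 \<longlonglongrightarrow> xs1"
      using odd_majorant_problem[OF R majorant kr(1,2)] alternating_not_tendsto_0[OF \<rho>_pos]
      by (intro exI conjI)
  qed
qed

end
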